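(* Let $E_1, E_2$ be Banach spaces, $T>0$, $p\in[1,+\infty]$, and let $B:E_1\to E_2$ be a (possibly nonlinear) compact operator. Let $U$ be a bounded subset of $L^1(0,T;E_1)$ such that $V=B(U)$ is a subset of $L^p(0,T;E_2)$ which is bounded in $L^r(0,T;E_2)$ for some $r>1$. Assume that $$\lim_{h\to 0^+}\|v(\cdot+h)-v\|_{L^p(0,T-h;E_2)}=0 \quad\text{uniformly for } v\in V.$$ Then $V$ is relatively compact in $L^p(0,T;E_2)$, and, if $p=+\infty$, $V$ is relatively compact in $\mathcal{C}([0,T];E_2)$.
   Context: A (nonlinear) operator $B:E_1\to E_2$ is called compact if it maps bounded subsets of $E_1$ to relatively compact subsets of $E_2$ (no continuity, linearity or monotonicity is assumed). For $u\in L^1(0,T;E_1)$, $B(u)$ denotes the function $t\mapsto B(u(t))$, and $B(U)=\{B(u):u\in U\}$. In the case $p=+\infty$, elements of $V$ are identified with their continuous representatives. *)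

theory Defs
  imports "HOL-Analysis.Analysis"
begin

text \<open>Bochner spaces L^p(S;E) on a Lebesgue measurable set S of reals, for an arbitrary
  (not necessarily separable) normed space E.  Functions are genuine functions
  real => E; only their values on S matter (a.e.).\<close>

definition strongly_measurable_on :: "real set \<Rightarrow> (real \<Rightarrow> 'a::real_normed_vector) \<Rightarrow> bool" where
  "strongly_measurable_on S f \<longleftrightarrow>
     (\<exists>g :: nat \<Rightarrow> real \<Rightarrow> 'a.
        (\<forall>n. finite (g n ` S) \<and> (\<forall>y. {t \<in> S. g n t = y} \<in> sets lebesgue)) \<and>
        (AE t in lebesgue. t \<in> S \<longrightarrow> (\<lambda>n. g n t) \<longlonglongrightarrow> f t))"

definition Lpnorm :: "real set \<Rightarrow> ennreal \<Rightarrow> (real \<Rightarrow> 'a::real_normed_vector) \<Rightarrow> ennreal" where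
  "Lpnorm S p f =
     (if p = top then Inf {C. AE t in lebesgue. t \<in> S \<longrightarrow> ennreal (norm (f t)) \<le> C}
      else (let I = (\<integral>\<^sup>+ t. indicator S t * ennreal (norm (f t) powr enn2real p) \<partial>lebesgue)
            in if I = top then top else ennreal (enn2real I powr (1 / enn2real p))))"

definition Lp_space :: "real set \<Rightarrow> ennreal \<Rightarrow> (real \<Rightarrow> 'a::real_normed_vector) set" where
  "Lp_space S p = {f. strongly_measurable_on S f \<and> Lpnorm S p f < top}"

definition compact_operator :: "('a::real_normed_vector \<Rightarrow> 'b::real_normed_vector) \<Rightarrow> bool" where
  "compact_operator B \<longleftrightarrow> (\<forall>S. bounded S \<longrightarrow> compact (closure (B ` S)))"

end

(* The proof samples instead of averaging. Cut (0,T) into N intervals of length d = T/N. For a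
   shift s in (0,d), compare v on the k-th interval with the single value v(s + k d). By Fubini,
   the mean over s of the resulting error is controlled by the translation modulus of v, and the
   mean over s of the sum of the norms |u(s + k d)| is controlled by the L^1 norm of u. Hence some
   s makes the step function with values v(s + k d) = B(u(s + k d)) close to v while all the points
   u(s + k d) lie in a ball whose radius depends only on N; so these values lie in a compact set.
   A diagonal argument over N gives a subsequence along which all the step functions converge, and
   the limits form a fast Cauchy sequence in L^p. For p = infinity the same Fubini argument first
   gives a continuous representative, and sampling replaces the pointwise compactness assumption
   of the Arzela-Ascoli theorem. *)
theory Submission
  imports Defs
begin

subsection \<open>Measurability of functions with values in a non-separable space\<close>

text \<open>Sampling uses point values, while the bounds on v hold only almost everywhere and the
  target space may be non-separable. Both obstacles are met by versions that are limits, at every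
  point, of Borel simple functions: they make \<open>norm (v t - v \<tau>)\<close> jointly
  measurable, so that Tonelli's theorem applies, and a null set can be avoided when the shift is
  chosen. A mean of v over a cell would mix in points where u is large, on which compactness of B
  gives no uniform information; a sample is a single value of B at a point of controlled size.
  Closeness of the step function and smallness of u have to hold for the same s, hence both
  quantities enter one weighted mean. The shift may depend on the function, but the grid and the
  compact set must be common to the whole sequence, since limits of the sampled values are extracted
  there. For finite p the estimates are made for q-th powers of norms, where the triangle inequality
  costs a factor \<open>2 powr q\<close>; the prescribed accuracies absorb this factor.\<close>

definition strong_borel :: "(real \<Rightarrow> 'a::real_normed_vector) \<Rightarrow> bool" where
  "strong_borel f \<longleftrightarrow>
     (\<exists>g. (\<forall>n::nat. simple_function borel (g n)) \<and> (\<forall>t. (\<lambda>n. g n t) \<longlonglongrightarrow> f t))"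

lemma simple_imp_strong_borel: "simple_function borel f \<Longrightarrow> strong_borel f"
  unfolding strong_borel_def by (rule exI[of _ "\<lambda>_. f"]) simp

lemma simple_function_precomp:
  assumes "simple_function N f" "g \<in> measurable M N"
  shows "simple_function M (\<lambda>x. f (g x))"
proof -
  have "finite ((\<lambda>x. f (g x)) ` space M)"
    using assms measurable_space[OF assms(2)]
    by (intro finite_subset[OF _ simple_functionD(1)[OF assms(1)]]) auto
  moreover have "(\<lambda>x. f (g x)) -` {y} \<inter> space M \<in> sets M" for y
  proof -
    have "(\<lambda>x. f (g x)) -` {y} \<inter> space M = g -` (f -` {y} \<inter> space N) \<inter> space M"
      using measurable_space[OF assms(2)] by auto
    then show ?thesis
      using measurable_sets[OF assms(2) simple_functionD(2)[OF assms(1)], of "{y}"] by simp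
  qed
  ultimately show ?thesis by (simp add: simple_function_def)
qed

text \<open>In a non-separable space subtraction need not be measurable for the product of the Borel
  sigma-algebras, so Borel measurability of \<open>f\<close> and \<open>g\<close> would not be
  enough. With approximants of finite range, each norm of a difference is a simple function on the
  product, and real limits of such functions are measurable.\<close>

lemma strong_borel_norm_diff:
  assumes "strong_borel f" "strong_borel g"
  shows "(\<lambda>x. norm (f (fst x) - g (snd x))) \<in> borel_measurable (borel \<Otimes>\<^sub>M borel)"
proof -
  obtain f' where f': "\<And>n::nat. simple_function borel (f' n)" "\<And>t. (\<lambda>n. f' n t) \<longlonglongrightarrow> f t"
    using assms(1) unfolding strong_borel_def by auto
  obtain g' where g': "\<And>n::nat. simple_function borel (g' n)" "\<And>t. (\<lambda>n. g' n t) \<longlonglongrightarrow> g t"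
    using assms(2) unfolding strong_borel_def by auto
  show ?thesis
  proof (rule borel_measurable_LIMSEQ_real)
    fix x :: "real \<times> real"
    show "(\<lambda>n. norm (f' n (fst x) - g' n (snd x))) \<longlonglongrightarrow> norm (f (fst x) - g (snd x))"
      by (intro tendsto_intros f' g')
  next
    fix n
    have "simple_function (borel \<Otimes>\<^sub>M borel) (\<lambda>x. f' n (fst x))"
      "simple_function (borel \<Otimes>\<^sub>M borel) (\<lambda>x. g' n (snd x))"
      using simple_function_precomp[OF f'(1) measurable_fst] simple_function_precomp[OF g'(1) measurable_snd]
      by blast+
    then have "simple_function (borel \<Otimes>\<^sub>M borel) (\<lambda>x. norm (f' n (fst x) - g' n (snd x)))"
      by (rule simple_function_compose2)
    then show "(\<lambda>x. norm (f' n (fst x) - g' n (snd x))) \<in> borel_measurable (borel \<Otimes>\<^sub>M borel)"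
      by (rule borel_measurable_simple_function)
  qed
qed

lemma strong_borel_norm_diff_compose [measurable (raw)]:
  assumes "strong_borel f" "strong_borel g"
    and [measurable]: "a \<in> borel_measurable M" "b \<in> borel_measurable M"
  shows "(\<lambda>x. norm (f (a x) - g (b x))) \<in> borel_measurable M"
proof -
  have "(\<lambda>x. (a x, b x)) \<in> measurable M (borel \<Otimes>\<^sub>M borel)" by measurable
  from measurable_compose[OF this strong_borel_norm_diff[OF assms(1,2)]] show ?thesis by simp
qed

lemma strong_borel_norm [measurable (raw)]:
  assumes "strong_borel f" "a \<in> borel_measurable M"
  shows "(\<lambda>x. norm (f (a x))) \<in> borel_measurable M"
  using strong_borel_norm_diff_compose[OF assms(1) simple_imp_strong_borel[of "\<lambda>_. 0"] assms(2,2)]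
  by simp

lemma AE_lborel_E:
  assumes "AE t in lborel. P t"
  obtains N where "N \<in> null_sets lborel" "\<And>t. t \<notin> N \<Longrightarrow> P t"
  using AE_E3[OF assms] by (metis DiffI UNIV_I space_borel space_lborel)

text \<open>Each Lebesgue simple approximant agrees with a Borel one off a null set. These countably
  many null sets, together with the one where convergence fails, lie in a single Borel null set
  \<open>N\<close>; setting everything to 0 on \<open>N\<close> gives convergence at every
  point.\<close>

lemma strongly_measurable_on_imp_strong_borel:
  assumes "strongly_measurable_on S f" "S \<in> sets lebesgue"
  obtains f' where "strong_borel f'" "AE t in lborel. t \<in> S \<longrightarrow> f t = f' t"
proof -
  obtain g where g: "\<And>n::nat. finite (g n ` S)" "\<And>n y. {t \<in> S. g n t = y} \<in> sets lebesgue"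
    and lim: "AE t in lebesgue. t \<in> S \<longrightarrow> (\<lambda>n. g n t) \<longlonglongrightarrow> f t"
    using assms(1) unfolding strongly_measurable_on_def by blast
  define g' where "g' n t = (if t \<in> S then g n t else 0)" for n t
  have "simple_function lebesgue (g' n)" for n
  proof -
    have "g' n ` UNIV \<subseteq> insert 0 (g n ` S)" by (auto simp: g'_def)
    then have "finite (range (g' n))" using g(1) finite_subset by blast
    moreover have "g' n -` {y} \<in> sets lebesgue" for y
    proof -
      have "g' n -` {y} = {t \<in> S. g n t = y} \<union> (if y = 0 then - S else {})"
        by (auto simp: g'_def split: if_splits)
      also have "\<dots> \<in> sets lebesgue"
        using g(2)[of n y] sets.compl_sets[OF assms(2)] by (auto intro!: sets.Un simp: Compl_eq_Diff_UNIV)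
      finally show ?thesis .
    qed
    ultimately show ?thesis by (simp add: simple_function_def)
  qed
  then have "\<exists>h. simple_function lborel h \<and> (AE t in lborel. g' n t = h t)" for n
    by (rule completion_ex_simple_function[of lborel])
  then obtain h where h: "\<And>n. simple_function lborel (h n)" "\<And>n. AE t in lborel. g' n t = h n t"
    by metis
  have "AE t in lborel. \<forall>n. g' n t = h n t"
    unfolding AE_all_countable using h(2) by blast
  then obtain N1 where N1: "N1 \<in> null_sets lborel" "\<And>t. t \<notin> N1 \<Longrightarrow> \<forall>n. g' n t = h n t"
    by (rule AE_lborel_E) auto
  have "AE t in lborel. t \<in> S \<longrightarrow> (\<lambda>n. g n t) \<longlonglongrightarrow> f t"
    using lim unfolding AE_completion_iff .
  then obtain N2 where N2: "N2 \<in> null_sets lborel"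
    "\<And>t. t \<notin> N2 \<Longrightarrow> t \<in> S \<longrightarrow> (\<lambda>n. g n t) \<longlonglongrightarrow> f t"
    by (rule AE_lborel_E) auto
  define N where "N = N1 \<union> N2"
  have N: "N \<in> null_sets lborel" unfolding N_def using N1(1) N2(1) by (rule null_sets.Un)
  have good: "g' n t = h n t" "t \<in> S \<Longrightarrow> (\<lambda>n. g n t) \<longlonglongrightarrow> f t" if "t \<notin> N" for n t
    using N1(2)[of t] N2(2)[of t] that by (auto simp: N_def)
  define f' where "f' t = (if t \<in> S - N then f t else 0)" for t
  show thesis
  proof
    show "strong_borel f'"
      unfolding strong_borel_def
    proof (intro exI conjI allI)
      fix n
      have "simple_function lborel (\<lambda>t. if t \<in> N then 0 else h n t)"
        using N h(1) by (intro simple_function_If_set) auto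
      then show "simple_function borel (\<lambda>t. if t \<in> N then 0 else h n t)"
        by (simp add: simple_function_def)
    next
      fix t
      show "(\<lambda>n. if t \<in> N then 0 else h n t) \<longlonglongrightarrow> f' t"
      proof (cases "t \<in> S - N")
        case True
        then show ?thesis using good[of t] by (auto simp: f'_def g'_def)
      next
        case False
        \<comment> \<open>Either \<open>t\<close> lies in \<open>N\<close>, or it lies outside
          \<open>S\<close>, where \<open>g'\<close> and hence \<open>h n\<close> vanish.\<close>
        then have "(if t \<in> N then 0 else h n t) = 0" for n using good(1)[of t n] by (auto simp: g'_def)
        moreover have "f' t = 0" using False by (auto simp: f'_def)
        ultimately show ?thesis by (simp only: tendsto_const)
      qed
    qed
    have "AE t in lborel. t \<notin> N" using N by (rule AE_not_in)
    then show "AE t in lborel. t \<in> S \<longrightarrow> f t = f' t"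
      by eventually_elim (auto simp: f'_def)
  qed
qed

section \<open>Almost everywhere statements and translations\<close>

lemma AE_lborel_interval_ex:
  fixes a b :: real
  assumes "AE t in lborel. P t" "a < b"
  obtains t where "a < t" "t < b" "P t"
proof (rule ccontr)
  assume "\<not> thesis"
  with that have *: "\<And>t. a < t \<Longrightarrow> t < b \<Longrightarrow> \<not> P t" by auto
  have "AE t in lborel. t \<notin> {a<..<b}" using assms(1) by eventually_elim (use * in auto)
  then have "{a<..<b} \<in> null_sets lborel" by (subst (asm) AE_iff_null_sets[symmetric]) auto
  then show False using assms(2) by (auto simp: null_sets_def)
qed

lemma AE_lborel_shift:
  fixes a :: real
  assumes "AE t in lborel. P t"
  shows "AE t in lborel. P (t + a)"
proof -
  obtain N where N: "N \<in> null_sets lborel" "\<And>t. t \<notin> N \<Longrightarrow> P t"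
    using assms by (rule AE_lborel_E) auto
  have "AE t in distr lborel borel ((+) a). t \<notin> N"
    unfolding lborel_distr_plus using N(1) by (rule AE_not_in)
  then have "AE t in lborel. a + t \<notin> N"
    by (rule AE_distrD[rotated]) simp
  then show ?thesis by eventually_elim (use N(2) in \<open>auto simp: add.commute\<close>)
qed

lemma nn_integral_lborel_shift:
  fixes a :: real
  assumes "f \<in> borel_measurable borel"
  shows "(\<integral>\<^sup>+x. f (x + a) \<partial>lborel) = (\<integral>\<^sup>+x. f x \<partial>lborel)"
  using nn_integral_real_affine[OF assms, of 1 a] by (simp add: add.commute)

subsection \<open>Choice of the sampling points\<close>

text \<open>The translates of the interval from 0 to \<open>\<delta>\<close> by multiples of
  \<open>\<delta>\<close> are disjoint subsets of the large interval, so the integrals of the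
  summands add up to at most the integral over it.\<close>

lemma nn_integral_sum_translates_le:
  fixes g :: "real \<Rightarrow> ennreal"
  assumes [measurable]: "g \<in> borel_measurable borel" and "0 < \<delta>"
  shows "(\<integral>\<^sup>+s. indicator {0<..<\<delta>} s * (\<Sum>k<N. g (s + real k * \<delta>)) \<partial>lborel)
    \<le> (\<integral>\<^sup>+t. indicator {0<..<real N * \<delta>} t * g t \<partial>lborel)"
proof (induction N)
  case 0
  show ?case by simp
next
  case (Suc N)
  have "(\<integral>\<^sup>+s. indicator {0<..<\<delta>} s * (\<Sum>k<Suc N. g (s + real k * \<delta>)) \<partial>lborel)
    = (\<integral>\<^sup>+s. indicator {0<..<\<delta>} s * (\<Sum>k<N. g (s + real k * \<delta>)) \<partial>lborel)
      + (\<integral>\<^sup>+s. indicator {0<..<\<delta>} ((s + real N * \<delta>) - real N * \<delta>) * g (s + real N * \<delta>) \<partial>lborel)"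
    by (subst nn_integral_add[symmetric]) (simp_all add: distrib_left)
  \<comment> \<open>The indicator was written in terms of \<open>s + real N * \<delta>\<close> so
    that the whole integrand is a function of the shifted variable.\<close>
  also have "(\<integral>\<^sup>+s. indicator {0<..<\<delta>} ((s + real N * \<delta>) - real N * \<delta>) * g (s + real N * \<delta>) \<partial>lborel)
    = (\<integral>\<^sup>+t. indicator {0<..<\<delta>} (t - real N * \<delta>) * g t \<partial>lborel)"
    by (rule nn_integral_lborel_shift) measurable
  also have "(\<integral>\<^sup>+s. indicator {0<..<\<delta>} s * (\<Sum>k<N. g (s + real k * \<delta>)) \<partial>lborel) + \<dots>
    \<le> (\<integral>\<^sup>+t. indicator {0<..<real N * \<delta>} t * g t \<partial>lborel) + \<dots>"
    by (intro add_mono Suc order_refl)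
  also have "\<dots> = (\<integral>\<^sup>+t. indicator {0<..<real N * \<delta>} t * g t
      + indicator {0<..<\<delta>} (t - real N * \<delta>) * g t \<partial>lborel)"
    by (subst nn_integral_add[symmetric]) simp_all
  also have "\<dots> \<le> (\<integral>\<^sup>+t. indicator {0<..<real (Suc N) * \<delta>} t * g t \<partial>lborel)"
  proof (rule nn_integral_mono)
    fix t :: real
    have "0 < t" if "\<delta> * real N < t" for t
      using that assms(2) by (smt (verit) mult_nonneg_nonneg of_nat_0_le_iff)
    then show "indicator {0<..<real N * \<delta>} t * g t + indicator {0<..<\<delta>} (t - real N * \<delta>) * g t
      \<le> indicator {0<..<real (Suc N) * \<delta>} t * g t"
      using assms(2) by (auto simp: indicator_def algebra_simps)
  qed
  finally show ?case .
qed

text \<open>If every admissible shift gave a sum of at least \<open>4 * \<eta>\<close>, integrating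
  over shifts of length \<open>\<delta>\<close> would give at least
  \<open>4 * \<delta> * \<eta>\<close>, against the bound \<open>3 * \<delta> * \<eta>\<close>. The
  gap between 3 and 4 makes the contradiction strict. The property \<open>P\<close> costs nothing:
  for almost every shift it holds at all grid translates in the interval.\<close>

lemma good_translate:
  fixes g :: "real \<Rightarrow> ennreal"
  assumes g: "g \<in> borel_measurable borel" and pos: "0 < \<delta>" "0 < \<eta>"
    and le: "(\<integral>\<^sup>+t. indicator {0<..<real N * \<delta>} t * g t \<partial>lborel) \<le> ennreal (3 * \<delta> * \<eta>)"
    and P: "AE t in lborel. t \<in> {0<..<real N * \<delta>} \<longrightarrow> P t"
  obtains s where "0 < s" "s < \<delta>" "\<And>k. k < N \<Longrightarrow> P (s + real k * \<delta>)"
    "(\<Sum>k<N. g (s + real k * \<delta>)) \<le> ennreal (4 * \<eta>)"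
proof (rule ccontr)
  assume "\<not> thesis"
  with that have bad: "ennreal (4 * \<eta>) \<le> (\<Sum>k<N. g (s + real k * \<delta>))"
    if "0 < s" "s < \<delta>" "\<forall>k<N. P (s + real k * \<delta>)" for s
    using that by (meson linear)
  have in_int: "s + real k * \<delta> \<in> {0<..<real N * \<delta>}" if "0 < s" "s < \<delta>" "k < N" for s k
  proof -
    have "real (Suc k) * \<delta> \<le> real N * \<delta>" using that pos by (intro mult_right_mono) auto
    moreover have "0 < s + \<delta> * real k" using that pos by (smt (verit) mult_nonneg_nonneg of_nat_0_le_iff)
    ultimately show ?thesis using that by (auto simp: algebra_simps)
  qed
  have "AE s in lborel. \<forall>k. s + real k * \<delta> \<in> {0<..<real N * \<delta>} \<longrightarrow> P (s + real k * \<delta>)"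
    unfolding AE_all_countable using AE_lborel_shift[OF P] by blast
  then have "AE s in lborel. indicator {0<..<\<delta>} s * ennreal (4 * \<eta>)
      \<le> indicator {0<..<\<delta>} s * (\<Sum>k<N. g (s + real k * \<delta>))"
    by eventually_elim (use bad in_int in \<open>auto simp: indicator_def\<close>)
  then have "(\<integral>\<^sup>+s. indicator {0<..<\<delta>} s * ennreal (4 * \<eta>) \<partial>lborel)
    \<le> (\<integral>\<^sup>+s. indicator {0<..<\<delta>} s * (\<Sum>k<N. g (s + real k * \<delta>)) \<partial>lborel)"
    by (rule nn_integral_mono_AE)
  also have "\<dots> \<le> ennreal (3 * \<delta> * \<eta>)"
    using nn_integral_sum_translates_le[OF g pos(1)] le by (rule order_trans)
  also have "(\<integral>\<^sup>+s. indicator {0<..<\<delta>} s * ennreal (4 * \<eta>) \<partial>lborel) = ennreal (4 * \<delta> * \<eta>)"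
    using pos by (subst nn_integral_multc) (auto simp: ennreal_mult[symmetric] algebra_simps)
  finally show False using pos by (auto simp: ennreal_le_iff)
qed

text \<open>Slicing the strip \<open>\<bar>t - \<tau>\<bar> < \<delta>\<close> along the lines \<open>\<tau> = t \<plusminus> h\<close>.\<close>

lemma nn_integral_strip_le:
  fixes K :: "real \<times> real \<Rightarrow> ennreal"
  assumes [measurable]: "K \<in> borel_measurable (borel \<Otimes>\<^sub>M borel)"
    and sym: "\<And>a b. K (a, b) = K (b, a)" and pos: "0 < \<delta>" "0 \<le> \<eta>"
    and le: "\<And>h. 0 < h \<Longrightarrow> h < \<delta> \<Longrightarrow>
      (\<integral>\<^sup>+t. indicator {0<..<T - h} t * K (t + h, t) \<partial>lborel) \<le> ennreal \<eta>"
  shows "(\<integral>\<^sup>+\<tau>. indicator {0<..<T} \<tau> *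
      (\<integral>\<^sup>+t. indicator {0<..<T} t * indicator {-\<delta><..<\<delta>} (t - \<tau>) * K (t, \<tau>) \<partial>lborel) \<partial>lborel)
    \<le> ennreal (2 * \<delta> * \<eta>)"
proof -
  \<comment> \<open>Only the half of the strip with \<open>\<tau> > t\<close> is kept; by symmetry
    of \<open>K\<close> the other half is \<open>Q\<close> with its arguments exchanged, which
    explains the factor 2 in the bound.\<close>
  define Q where "Q t \<tau> = indicator {0<..<T} \<tau> * indicator {0<..<T} t *
    indicator {0<..<\<delta>} (\<tau> - t) * K (t, \<tau>)" for t \<tau> :: real
  have Qm [measurable (raw)]: "(\<lambda>x. Q (a x) (b x)) \<in> borel_measurable M"
    if [measurable]: "a \<in> borel_measurable M" "b \<in> borel_measurable M" for a b :: "'x \<Rightarrow> real" and M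
    unfolding Q_def by measurable
  define A where "A = (\<integral>\<^sup>+t. \<integral>\<^sup>+\<tau>. Q t \<tau> \<partial>lborel \<partial>lborel)"
  have swap: "(\<integral>\<^sup>+\<tau>. \<integral>\<^sup>+t. Q t \<tau> \<partial>lborel \<partial>lborel) = A"
    unfolding A_def by (rule lborel_pair.Fubini') measurable
  \<comment> \<open>The substitution \<open>\<tau> = h + t\<close> turns the half strip into slices
    of constant \<open>h\<close>, each an integral of the translation type.\<close>
  have "A = (\<integral>\<^sup>+t. \<integral>\<^sup>+h. Q t (h + t) \<partial>lborel \<partial>lborel)"
    unfolding A_def by (intro nn_integral_cong nn_integral_lborel_shift[symmetric]) measurable
  also have "\<dots> = (\<integral>\<^sup>+h. \<integral>\<^sup>+t. Q t (h + t) \<partial>lborel \<partial>lborel)"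
    by (rule lborel_pair.Fubini'[symmetric]) measurable
  also have "\<dots> \<le> (\<integral>\<^sup>+h. indicator {0<..<\<delta>} h * ennreal \<eta> \<partial>lborel)"
  proof (rule nn_integral_mono)
    fix h :: real
    show "(\<integral>\<^sup>+t. Q t (h + t) \<partial>lborel) \<le> indicator {0<..<\<delta>} h * ennreal \<eta>"
    proof (cases "0 < h \<and> h < \<delta>")
      case True
      have "(\<integral>\<^sup>+t. Q t (h + t) \<partial>lborel)
        \<le> (\<integral>\<^sup>+t. indicator {0<..<T - h} t * K (t + h, t) \<partial>lborel)"
        using True by (intro nn_integral_mono)
          (auto simp: Q_def indicator_def sym[of "_ + _"] add.commute[of h])
      with le[of h] True show ?thesis by (simp add: order_trans)
    next
      case False
      then have "Q t (h + t) = 0" for t by (auto simp: Q_def)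
      then show ?thesis by simp
    qed
  qed
  also have "\<dots> = ennreal (\<delta> * \<eta>)"
    using pos by (subst nn_integral_multc) (auto simp: ennreal_mult[symmetric])
  finally have A: "A \<le> ennreal (\<delta> * \<eta>)" .
  have "(\<integral>\<^sup>+\<tau>. indicator {0<..<T} \<tau> *
      (\<integral>\<^sup>+t. indicator {0<..<T} t * indicator {-\<delta><..<\<delta>} (t - \<tau>) * K (t, \<tau>) \<partial>lborel) \<partial>lborel)
    = (\<integral>\<^sup>+\<tau>. (\<integral>\<^sup>+t. Q t \<tau> + Q \<tau> t \<partial>lborel) \<partial>lborel)"
  proof (rule nn_integral_cong)
    fix \<tau> :: real
    have "indicator {0<..<T} \<tau> *
      (\<integral>\<^sup>+t. indicator {0<..<T} t * indicator {-\<delta><..<\<delta>} (t - \<tau>) * K (t, \<tau>) \<partial>lborel)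
      = (\<integral>\<^sup>+t. indicator {0<..<T} \<tau> *
          (indicator {0<..<T} t * indicator {-\<delta><..<\<delta>} (t - \<tau>) * K (t, \<tau>)) \<partial>lborel)"
      by (rule nn_integral_cmult[symmetric]) measurable
    also have "\<dots> = (\<integral>\<^sup>+t. Q t \<tau> + Q \<tau> t \<partial>lborel)"
    proof (rule nn_integral_cong_AE)
      \<comment> \<open>The two halves miss the diagonal \<open>t = \<tau>\<close>, which is a null
        set for each \<open>\<tau>\<close>.\<close>
      have "AE t in lborel. t \<noteq> \<tau>" by (rule AE_lborel_singleton)
      then show "AE t in lborel. indicator {0<..<T} \<tau> *
          (indicator {0<..<T} t * indicator {-\<delta><..<\<delta>} (t - \<tau>) * K (t, \<tau>)) = Q t \<tau> + Q \<tau> t"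
      proof eventually_elim
        case (elim t)
        show ?case
        proof (cases "t < \<tau>")
          case True
          then show ?thesis by (auto simp: Q_def indicator_def)
        next
          case False
          with elim have "\<tau> < t" by simp
          then show ?thesis by (auto simp: Q_def indicator_def sym[of \<tau> t])
        qed
      qed
    qed
    finally show "indicator {0<..<T} \<tau> *
      (\<integral>\<^sup>+t. indicator {0<..<T} t * indicator {-\<delta><..<\<delta>} (t - \<tau>) * K (t, \<tau>) \<partial>lborel)
      = (\<integral>\<^sup>+t. Q t \<tau> + Q \<tau> t \<partial>lborel)" .
  qed
  also have "\<dots> = (\<integral>\<^sup>+\<tau>. (\<integral>\<^sup>+t. Q t \<tau> \<partial>lborel) + (\<integral>\<^sup>+t. Q \<tau> t \<partial>lborel) \<partial>lborel)"
    by (intro nn_integral_cong nn_integral_add) measurable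
  also have "\<dots> = (\<integral>\<^sup>+\<tau>. (\<integral>\<^sup>+t. Q t \<tau> \<partial>lborel) \<partial>lborel) + (\<integral>\<^sup>+\<tau>. (\<integral>\<^sup>+t. Q \<tau> t \<partial>lborel) \<partial>lborel)"
    by (intro nn_integral_add) measurable
  also have "\<dots> = A + A" by (simp only: swap) (simp only: A_def)
  also have "\<dots> \<le> ennreal (\<delta> * \<eta>) + ennreal (\<delta> * \<eta>)" by (intro add_mono A)
  also have "\<dots> = ennreal (2 * \<delta> * \<eta>)" using pos by (simp add: ennreal_plus[symmetric] del: ennreal_plus)
  finally show ?thesis .
qed

text \<open>The weight \<open>\<delta> * \<eta> / C\<close> brings the integral of \<open>u\<close>
  to at most \<open>\<delta> * \<eta>\<close>; with the strip bound
  \<open>2 * \<delta> * \<eta>\<close> this is the total \<open>3 * \<delta> * \<eta>\<close> of the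
  preceding selection. Since both parts of \<open>g\<close> are nonnegative, the resulting bound
  \<open>4 * \<eta>\<close> holds for each. Dividing by the weight cancels \<open>\<eta>\<close>, so
  the bound \<open>4 * C / \<delta>\<close> on the samples of \<open>u\<close> depends on the grid
  only.\<close>

lemma good_translate_slices:
  fixes K :: "real \<times> real \<Rightarrow> ennreal" and u :: "real \<Rightarrow> ennreal"
  assumes K [measurable]: "K \<in> borel_measurable (borel \<Otimes>\<^sub>M borel)"
    and sym: "\<And>a b. K (a, b) = K (b, a)"
    and u [measurable]: "u \<in> borel_measurable borel"
    and pos: "0 < \<delta>" "0 < \<eta>" "0 < C"
    and le_u: "(\<integral>\<^sup>+t. indicator {0<..<real N * \<delta>} t * u t \<partial>lborel) \<le> ennreal C"
    and le_K: "\<And>h. 0 < h \<Longrightarrow> h < \<delta> \<Longrightarrow>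
      (\<integral>\<^sup>+t. indicator {0<..<real N * \<delta> - h} t * K (t + h, t) \<partial>lborel) \<le> ennreal \<eta>"
    and P: "AE t in lborel. t \<in> {0<..<real N * \<delta>} \<longrightarrow> P t"
  obtains s where "0 < s" "s < \<delta>"
    "\<And>k. k < N \<Longrightarrow> P (s + real k * \<delta>)"
    "\<And>k. k < N \<Longrightarrow> u (s + real k * \<delta>) \<le> ennreal (4 * C / \<delta>)"
    "(\<Sum>k<N. \<integral>\<^sup>+t. indicator {0<..<real N * \<delta>} t * indicator {-\<delta><..<\<delta>} (t - (s + real k * \<delta>))
        * K (t, s + real k * \<delta>) \<partial>lborel) \<le> ennreal (4 * \<eta>)"
proof -
  define I where "I = {0<..<real N * \<delta>}"
  have [measurable]: "I \<in> sets borel" by (simp add: I_def)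
  define H where "H \<tau> = (\<integral>\<^sup>+t. indicator I t * indicator {-\<delta><..<\<delta>} (t - \<tau>) * K (t, \<tau>) \<partial>lborel)" for \<tau>
  have [measurable]: "H \<in> borel_measurable borel" unfolding H_def by measurable
  define g where "g \<tau> = H \<tau> + ennreal (\<delta> * \<eta> / C) * u \<tau>" for \<tau>
  have [measurable]: "g \<in> borel_measurable borel" unfolding g_def by measurable
  have "(\<integral>\<^sup>+\<tau>. indicator I \<tau> * g \<tau> \<partial>lborel)
    = (\<integral>\<^sup>+\<tau>. indicator I \<tau> * H \<tau> + ennreal (\<delta> * \<eta> / C) * (indicator I \<tau> * u \<tau>) \<partial>lborel)"
    by (simp add: g_def distrib_left mult.left_commute)
  also have "\<dots> = (\<integral>\<^sup>+\<tau>. indicator I \<tau> * H \<tau> \<partial>lborel)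
      + ennreal (\<delta> * \<eta> / C) * (\<integral>\<^sup>+\<tau>. indicator I \<tau> * u \<tau> \<partial>lborel)"
    by (subst nn_integral_add) (simp_all add: nn_integral_cmult)
  also have "\<dots> \<le> ennreal (2 * \<delta> * \<eta>) + ennreal (\<delta> * \<eta> / C) * ennreal C"
    unfolding H_def I_def using nn_integral_strip_le[OF K sym pos(1) _ le_K] pos le_u
    by (intro add_mono mult_left_mono) auto
  also have "\<dots> = ennreal (3 * \<delta> * \<eta>)"
    using pos by (simp add: ennreal_mult[symmetric] ennreal_plus[symmetric] del: ennreal_plus)
  finally have "(\<integral>\<^sup>+\<tau>. indicator {0<..<real N * \<delta>} \<tau> * g \<tau> \<partial>lborel) \<le> ennreal (3 * \<delta> * \<eta>)"
    by (simp add: I_def)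
  then obtain s where s: "0 < s" "s < \<delta>" "\<And>k. k < N \<Longrightarrow> P (s + real k * \<delta>)"
    and sum: "(\<Sum>k<N. g (s + real k * \<delta>)) \<le> ennreal (4 * \<eta>)"
    by (rule good_translate[OF \<open>g \<in> borel_measurable borel\<close> pos(1,2) _ P]) blast
  show thesis
  proof (rule that[OF s])
    fix k assume "k < N"
    then have "g (s + real k * \<delta>) \<le> (\<Sum>k<N. g (s + real k * \<delta>))"
      by (intro member_le_sum) auto
    moreover have "ennreal (\<delta> * \<eta> / C) * u (s + real k * \<delta>) \<le> g (s + real k * \<delta>)"
      unfolding g_def by (rule add_increasing) simp_all
    ultimately have "ennreal (\<delta> * \<eta> / C) * u (s + real k * \<delta>) \<le> ennreal (4 * \<eta>)"
      using sum by (meson order_trans)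
    then have "ennreal (C / (\<delta> * \<eta>)) * (ennreal (\<delta> * \<eta> / C) * u (s + real k * \<delta>))
      \<le> ennreal (C / (\<delta> * \<eta>)) * ennreal (4 * \<eta>)"
      by (rule mult_left_mono) simp
    moreover have "ennreal (C / (\<delta> * \<eta>)) * (ennreal (\<delta> * \<eta> / C) * u (s + real k * \<delta>))
      = u (s + real k * \<delta>)"
      using pos by (simp add: mult.assoc[symmetric] ennreal_mult[symmetric])
    moreover have "ennreal (C / (\<delta> * \<eta>)) * ennreal (4 * \<eta>) = ennreal (4 * C / \<delta>)"
      using pos by (simp add: ennreal_mult[symmetric])
    ultimately show "u (s + real k * \<delta>) \<le> ennreal (4 * C / \<delta>)" by simp
  next
    have "(\<Sum>k<N. H (s + real k * \<delta>)) \<le> (\<Sum>k<N. g (s + real k * \<delta>))"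
      by (intro sum_mono) (simp add: g_def)
    with sum show "(\<Sum>k<N. \<integral>\<^sup>+t. indicator {0<..<real N * \<delta>} t *
        indicator {-\<delta><..<\<delta>} (t - (s + real k * \<delta>)) * K (t, s + real k * \<delta>) \<partial>lborel) \<le> ennreal (4 * \<eta>)"
      unfolding H_def I_def by (rule order_trans[rotated])
  qed
qed

section \<open>Step functions on a uniform grid\<close>

definition cell :: "real \<Rightarrow> nat \<Rightarrow> real \<Rightarrow> nat" where
  "cell \<delta> N t = (if t \<in> {0<..<real N * \<delta>} then nat \<lfloor>t / \<delta>\<rfloor> else N)"

text \<open>The index \<open>N\<close>, which \<open>cell\<close> returns off the open interval, is
  one past the last cell and selects the value 0.\<close>

definition step_fun :: "real \<Rightarrow> nat \<Rightarrow> (nat \<Rightarrow> 'b) \<Rightarrow> real \<Rightarrow> 'b::zero" where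
  "step_fun \<delta> N a t = (if cell \<delta> N t < N then a (cell \<delta> N t) else 0)"

lemma cell_bounds:
  assumes "0 < \<delta>" "t \<in> {0<..<real N * \<delta>}"
  shows "cell \<delta> N t < N" "real (cell \<delta> N t) * \<delta> \<le> t" "t < real (cell \<delta> N t) * \<delta> + \<delta>"
proof -
  have eq: "real (cell \<delta> N t) = of_int \<lfloor>t / \<delta>\<rfloor>" using assms by (simp add: cell_def)
  have 1: "of_int \<lfloor>t / \<delta>\<rfloor> \<le> t / \<delta>" "t / \<delta> < of_int \<lfloor>t / \<delta>\<rfloor> + 1" by linarith+
  have "t / \<delta> < real N" using assms by (simp add: field_simps)
  with 1 eq have "real (cell \<delta> N t) < real N" by linarith
  then show "cell \<delta> N t < N" by simp
  show "real (cell \<delta> N t) * \<delta> \<le> t"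
    unfolding eq using 1(1) assms(1) by (simp only: pos_le_divide_eq)
  show "t < real (cell \<delta> N t) * \<delta> + \<delta>"
    unfolding eq using 1(2) assms(1) by (simp add: pos_divide_less_eq algebra_simps)
qed

text \<open>The step function factors through the measurable, finite-valued index
  \<open>cell\<close>, so its values may be arbitrary elements of the target.\<close>

lemma simple_function_step_fun:
  assumes "0 < \<delta>"
  shows "simple_function borel (step_fun \<delta> N a)"
proof -
  have "cell \<delta> N t \<le> N" for t
    using cell_bounds(1)[OF assms, of t N] by (cases "t \<in> {0<..<real N * \<delta>}") (auto simp: cell_def)
  then have "finite (range (cell \<delta> N))" by (auto intro!: finite_subset[OF _ finite_atMost[of N]])
  moreover have "cell \<delta> N \<in> borel_measurable borel" unfolding cell_def by measurable
  ultimately have "simple_function borel (cell \<delta> N)"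
    by (intro simple_function_borel_measurable) auto
  then have "simple_function borel (\<lambda>t. (\<lambda>k. if k < N then a k else 0) (cell \<delta> N t))"
    by (rule simple_function_compose1)
  then show ?thesis unfolding step_fun_def by simp
qed

text \<open>The q-th power of the norm of L^q. It is additive under decompositions of the domain and
  works directly with Tonelli's theorem and Fatou's lemma; roots are taken only when the result is
  translated back to \<open>Lpnorm\<close>.\<close>

definition power_integral :: "real \<Rightarrow> real set \<Rightarrow> (real \<Rightarrow> 'a::real_normed_vector) \<Rightarrow> ennreal" where
  "power_integral q S f = (\<integral>\<^sup>+t. indicator S t * ennreal (norm (f t) powr q) \<partial>lborel)"

text \<open>A point \<open>t\<close> of the k-th cell and the sampling point
  \<open>s + real k * \<delta>\<close> are less than \<open>\<delta>\<close> apart, so the error at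
  \<open>t\<close> is one term of the sum of strip integrands that the choice of \<open>s\<close>
  keeps small.\<close>

lemma step_fun_approximation:
  fixes v :: "real \<Rightarrow> 'b::real_normed_vector"
  assumes v: "strong_borel v" and u: "u \<in> borel_measurable borel"
    and pos: "0 < \<delta>" "0 < \<eta>" "0 < C"
    and le_u: "(\<integral>\<^sup>+t. indicator {0<..<real N * \<delta>} t * u t \<partial>lborel) \<le> ennreal C"
    and le_v: "\<And>h. 0 < h \<Longrightarrow> h < \<delta> \<Longrightarrow>
      power_integral q {0<..<real N * \<delta> - h} (\<lambda>t. v (t + h) - v t) \<le> ennreal \<eta>"
    and P: "AE t in lborel. t \<in> {0<..<real N * \<delta>} \<longrightarrow> P t"
  obtains s where "0 < s" "s < \<delta>"
    "\<And>k. k < N \<Longrightarrow> P (s + real k * \<delta>)"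
    "\<And>k. k < N \<Longrightarrow> u (s + real k * \<delta>) \<le> ennreal (4 * C / \<delta>)"
    "power_integral q {0<..<real N * \<delta>} (\<lambda>t. v t - step_fun \<delta> N (\<lambda>k. v (s + real k * \<delta>)) t) \<le> ennreal (4 * \<eta>)"
proof -
  define K where "K x = ennreal (norm (v (fst x) - v (snd x)) powr q)" for x
  have K [measurable]: "K \<in> borel_measurable (borel \<Otimes>\<^sub>M borel)"
    unfolding K_def using strong_borel_norm_diff[OF v v] by measurable
  have sym: "K (a, b) = K (b, a)" for a b by (simp add: K_def norm_minus_commute)
  obtain s where s: "0 < s" "s < \<delta>"
    "\<And>k. k < N \<Longrightarrow> P (s + real k * \<delta>)"
    "\<And>k. k < N \<Longrightarrow> u (s + real k * \<delta>) \<le> ennreal (4 * C / \<delta>)"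
    and sum: "(\<Sum>k<N. \<integral>\<^sup>+t. indicator {0<..<real N * \<delta>} t * indicator {-\<delta><..<\<delta>} (t - (s + real k * \<delta>))
        * K (t, s + real k * \<delta>) \<partial>lborel) \<le> ennreal (4 * \<eta>)"
  proof (rule good_translate_slices[OF K sym u pos le_u _ P])
    show "(\<integral>\<^sup>+t. indicator {0<..<real N * \<delta> - h} t * K (t + h, t) \<partial>lborel) \<le> ennreal \<eta>"
      if "0 < h" "h < \<delta>" for h
      using le_v[OF that] by (simp add: K_def power_integral_def)
  qed blast
  have "power_integral q {0<..<real N * \<delta>} (\<lambda>t. v t - step_fun \<delta> N (\<lambda>k. v (s + real k * \<delta>)) t)
    \<le> (\<integral>\<^sup>+t. (\<Sum>k<N. indicator {0<..<real N * \<delta>} t * indicator {-\<delta><..<\<delta>} (t - (s + real k * \<delta>))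
        * K (t, s + real k * \<delta>)) \<partial>lborel)"
    unfolding power_integral_def
  proof (rule nn_integral_mono)
    fix t :: real
    let ?F = "\<lambda>k. indicator {0<..<real N * \<delta>} t * indicator {-\<delta><..<\<delta>} (t - (s + real k * \<delta>))
        * K (t, s + real k * \<delta>)"
    show "indicator {0<..<real N * \<delta>} t *
        ennreal (norm (v t - step_fun \<delta> N (\<lambda>k. v (s + real k * \<delta>)) t) powr q) \<le> (\<Sum>k<N. ?F k)"
    proof (cases "t \<in> {0<..<real N * \<delta>}")
      case True
      define k where "k = cell \<delta> N t"
      note b = cell_bounds[OF pos(1) True, folded k_def]
      \<comment> \<open>All other summands are nonnegative and are discarded.\<close>
      have "?F k \<le> (\<Sum>k<N. ?F k)" using b(1) by (intro member_le_sum) auto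
      moreover have "t - (s + real k * \<delta>) \<in> {-\<delta><..<\<delta>}" using b s(1,2) by auto
      ultimately show ?thesis
        using True b(1) by (simp add: step_fun_def K_def flip: k_def)
    qed simp
  qed
  also have "\<dots> = (\<Sum>k<N. \<integral>\<^sup>+t. indicator {0<..<real N * \<delta>} t * indicator {-\<delta><..<\<delta>} (t - (s + real k * \<delta>))
        * K (t, s + real k * \<delta>) \<partial>lborel)"
    by (rule nn_integral_sum) measurable
  also note sum
  finally show thesis using that s by blast
qed

text \<open>Tychonoff's theorem in place of successive extractions: the arrays indexed by pairs
  (level \<open>m\<close>, cell \<open>k\<close>) lie in a product of compact sets, and a countable
  product of metric spaces is first countable, so compactness yields a convergent subsequence.
  Convergence in the product is convergence of every entry.\<close>

lemma compact_double_subsequence: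
  fixes a :: "nat \<Rightarrow> nat \<Rightarrow> nat \<Rightarrow> 'b::metric_space"
  assumes "\<And>m. compact (K m)" "\<And>n m k. a n m k \<in> K m"
  obtains \<phi> l where "strict_mono \<phi>" "\<And>m k. (\<lambda>n. a (\<phi> n) m k) \<longlonglongrightarrow> l m k"
proof -
  define X :: "(nat \<times> nat \<Rightarrow> 'b) set" where "X = PiE UNIV (\<lambda>x. K (fst x))"
  have "compactin (product_topology (\<lambda>_. euclidean) UNIV) X"
    unfolding X_def compactin_PiE using assms(1) by simp
  then have "compact X" by (simp add: euclidean_product_topology)
  then have X: "seq_compact X" by (rule compact_imp_seq_compact)
  define b where "b n = (\<lambda>x. a n (fst x) (snd x))" for n
  have "\<forall>n. b n \<in> X" using assms(2) by (auto simp: X_def b_def)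
  with X obtain l r where lr: "strict_mono r" "(b \<circ> r) \<longlonglongrightarrow> l"
    unfolding seq_compact_def by blast
  show thesis
  proof (rule that[OF lr(1)])
    fix m k
    have "isCont (\<lambda>f :: nat \<times> nat \<Rightarrow> 'b. f (m, k)) l"
      by (rule continuous_on_interior[of UNIV, OF continuous_on_product_coordinates]) simp
    from isCont_tendsto_compose[OF this lr(2)]
    show "(\<lambda>n. a (r n) m k) \<longlonglongrightarrow> l (m, k)" by (simp add: b_def)
  qed
qed

subsection \<open>The case \<open>p = \<infinity>\<close>\<close>

lemma fine_partition:
  fixes T d :: real
  assumes "0 < T" "0 < d"
  obtains N \<delta> where "0 < N" "0 < \<delta>" "\<delta> < d" "real N * \<delta> = T"
proof -
  obtain N :: nat where N: "T / d < real N" using reals_Archimedean2 by blast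
  moreover have "0 < T / d" using assms by simp
  ultimately have "0 < real N" by linarith
  with N assms show thesis by (intro that[of N "T / real N"]) (auto simp: field_simps)
qed

text \<open>The complement of a null set meets every interval of positive length. This density lets
  almost everywhere bounds pass to all points of the closed interval by continuity.\<close>

lemma closure_AE_interval:
  fixes a b :: real
  assumes P: "AE t in lborel. t \<in> {a<..<b} \<longrightarrow> P t" and "a < b"
  shows "closure {t \<in> {a<..<b}. P t} = {a..b}"
proof
  show "closure {t \<in> {a<..<b}. P t} \<subseteq> {a..b}" by (rule closure_minimal) auto
  show "{a..b} \<subseteq> closure {t \<in> {a<..<b}. P t}"
  proof
    fix x assume x: "x \<in> {a..b}"
    show "x \<in> closure {t \<in> {a<..<b}. P t}"
      unfolding closure_approachable
    proof (intro allI impI)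
      fix e :: real assume "0 < e"
      then have "max a (x - e) < min b (x + e)" using x assms(2) by auto
      from AE_lborel_interval_ex[OF P this] obtain t where
        "max a (x - e) < t" "t < min b (x + e)" "t \<in> {a<..<b} \<longrightarrow> P t" by blast
      then show "\<exists>t\<in>{t \<in> {a<..<b}. P t}. dist t x < e"
        by (intro bexI[of _ t]) (auto simp: dist_real_def)
    qed
  qed
qed

section \<open>From almost everywhere translation bounds to continuous representatives\<close>

lemma continuous_AE_shift_bound:
  fixes w :: "real \<Rightarrow> 'b::real_normed_vector"
  assumes cont: "continuous_on {0..T} w" and h: "0 < h" "h < T"
    and AE: "AE t in lborel. t \<in> {0<..<T - h} \<longrightarrow> norm (w (t + h) - w t) \<le> \<epsilon>"
    and t: "0 \<le> t" "t \<le> T - h"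
  shows "norm (w (t + h) - w t) \<le> \<epsilon>"
proof -
  define G where "G = {t \<in> {0<..<T - h}. norm (w (t + h) - w t) \<le> \<epsilon>}"
  have cl: "closure G = {0..T - h}" unfolding G_def using AE h by (intro closure_AE_interval) auto
  have "continuous_on {0..T - h} (\<lambda>t. w (t + h))"
    by (rule continuous_on_compose2[OF cont]) (use h in \<open>auto intro!: continuous_intros\<close>)
  moreover have "continuous_on {0..T - h} w" by (rule continuous_on_subset[OF cont]) (use h in auto)
  ultimately have "continuous_on (closure G) (\<lambda>t. norm (w (t + h) - w t))"
    unfolding cl by (intro continuous_intros)
  then show ?thesis
    by (rule continuous_le_on_closure) (use cl t in \<open>auto simp: G_def\<close>)
qed

text \<open>The exceptional null set depends on \<open>h\<close>, and there are uncountably many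
  \<open>h\<close>, so the sets cannot simply be united. The strip estimate is applied instead to
  the indicator of the pairs violating the bound: every slice has measure zero, hence so has the
  strip, and by Tonelli's theorem so have almost all its sections.\<close>

lemma AE_shift_bound_imp_AE_AE:
  fixes v :: "real \<Rightarrow> 'b::real_normed_vector"
  assumes v: "strong_borel v" and d: "0 < d"
    and AE: "\<And>h. 0 < h \<Longrightarrow> h < d \<Longrightarrow>
      AE t in lborel. t \<in> {0<..<T - h} \<longrightarrow> norm (v (t + h) - v t) \<le> \<epsilon>"
  shows "AE \<tau> in lborel. \<tau> \<in> {0<..<T} \<longrightarrow>
    (AE t in lborel. t \<in> {0<..<T} \<longrightarrow> \<bar>t - \<tau>\<bar> < d \<longrightarrow> norm (v t - v \<tau>) \<le> \<epsilon>)"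
proof -
  define K :: "real \<times> real \<Rightarrow> ennreal" where
    "K x = indicator {\<epsilon><..} (norm (v (fst x) - v (snd x)))" for x
  have K [measurable]: "K \<in> borel_measurable (borel \<Otimes>\<^sub>M borel)"
    unfolding K_def using strong_borel_norm_diff[OF v v] by measurable
  have sym: "K (a, b) = K (b, a)" for a b by (simp add: K_def norm_minus_commute)
  define H where "H \<tau> = (\<integral>\<^sup>+t. indicator {0<..<T} t * indicator {-d<..<d} (t - \<tau>) * K (t, \<tau>) \<partial>lborel)" for \<tau>
  have [measurable]: "H \<in> borel_measurable borel" unfolding H_def by measurable
  have "(\<integral>\<^sup>+t. indicator {0<..<T - h} t * K (t + h, t) \<partial>lborel) \<le> ennreal 0" if h: "0 < h" "h < d" for h
  proof -
    have "AE t in lborel. indicator {0<..<T - h} t * K (t + h, t) = 0"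
      using AE[OF h] by eventually_elim (auto simp: K_def indicator_def)
    from nn_integral_cong_AE[where v = "\<lambda>_. 0", OF this] show ?thesis by simp
  qed
  from nn_integral_strip_le[OF K sym d order_refl this]
  have "(\<integral>\<^sup>+\<tau>. indicator {0<..<T} \<tau> * H \<tau> \<partial>lborel) = 0"
    unfolding H_def by simp
  then have "AE \<tau> in lborel. indicator {0<..<T} \<tau> * H \<tau> = 0"
    by (subst (asm) nn_integral_0_iff_AE) measurable
  then show ?thesis
  proof (eventually_elim, intro impI)
    fix \<tau> assume "indicator {0<..<T} \<tau> * H \<tau> = 0" "\<tau> \<in> {0<..<T}"
    then have "H \<tau> = 0" by simp
    then have "AE t in lborel. indicator {0<..<T} t * indicator {-d<..<d} (t - \<tau>) * K (t, \<tau>) = 0"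
      unfolding H_def by (subst (asm) nn_integral_0_iff_AE) measurable
    then show "AE t in lborel. t \<in> {0<..<T} \<longrightarrow> \<bar>t - \<tau>\<bar> < d \<longrightarrow> norm (v t - v \<tau>) \<le> \<epsilon>"
      by eventually_elim (auto simp: K_def indicator_def split: if_splits)
  qed
qed

text \<open>A point is good if the bounds around it hold for almost every \<open>t\<close>. Almost
  every point is good, so good points are dense, and \<open>v\<close> is uniformly continuous on
  them.\<close>

lemma continuous_representative:
  fixes v :: "real \<Rightarrow> 'b::banach"
  assumes v: "strong_borel v" and T: "0 < T"
    and transl: "\<And>\<epsilon>. 0 < \<epsilon> \<Longrightarrow> \<exists>d>0. \<forall>h. 0 < h \<and> h < d \<longrightarrow>
      (AE t in lborel. t \<in> {0<..<T - h} \<longrightarrow> norm (v (t + h) - v t) \<le> \<epsilon>)"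
  obtains w where "continuous_on {0..T} w" "AE t in lborel. t \<in> {0<..<T} \<longrightarrow> v t = w t"
proof -
  have "\<exists>d>0. \<forall>h. 0 < h \<and> h < d \<longrightarrow>
      (AE t in lborel. t \<in> {0<..<T - h} \<longrightarrow> norm (v (t + h) - v t) \<le> 1 / real (Suc n))" for n
    by (rule transl) simp
  then obtain d where d: "\<And>n. 0 < d n" "\<And>n h. 0 < h \<Longrightarrow> h < d n \<Longrightarrow>
      AE t in lborel. t \<in> {0<..<T - h} \<longrightarrow> norm (v (t + h) - v t) \<le> 1 / real (Suc n)"
    by metis
  \<comment> \<open>Only the countably many tolerances \<open>1 / real (Suc n)\<close> are used, so
    that one null set serves them all.\<close>
  define good where "good \<tau> \<longleftrightarrow> (AE t in lborel. t \<in> {0<..<T} \<longrightarrow>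
    (\<forall>n. \<bar>t - \<tau>\<bar> < d n \<longrightarrow> norm (v t - v \<tau>) \<le> 1 / real (Suc n)))" for \<tau>
  have "AE \<tau> in lborel. \<forall>n. \<tau> \<in> {0<..<T} \<longrightarrow>
    (AE t in lborel. t \<in> {0<..<T} \<longrightarrow> \<bar>t - \<tau>\<bar> < d n \<longrightarrow> norm (v t - v \<tau>) \<le> 1 / real (Suc n))"
    unfolding AE_all_countable by (intro allI AE_shift_bound_imp_AE_AE v d)
  then have AE_good: "AE \<tau> in lborel. \<tau> \<in> {0<..<T} \<longrightarrow> good \<tau>"
  proof eventually_elim
    case (elim \<tau>)
    show ?case
    proof
      assume "\<tau> \<in> {0<..<T}"
      with elim have "AE t in lborel. \<forall>n. t \<in> {0<..<T} \<longrightarrow> \<bar>t - \<tau>\<bar> < d n \<longrightarrow> norm (v t - v \<tau>) \<le> 1 / real (Suc n)"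
        unfolding AE_all_countable by blast
      then show "good \<tau>" unfolding good_def by eventually_elim blast
    qed
  qed
  define G where "G = {\<tau> \<in> {0<..<T}. good \<tau>}"
  have cl: "closure G = {0..T}" unfolding G_def by (rule closure_AE_interval[OF AE_good T])
  text \<open>Two good points are compared through a common good point lying between them.\<close>
  have close: "norm (v y - v x) \<le> 2 / real (Suc n)" if "x \<in> G" "y \<in> G" "x < y" "y - x < d n" for x y n
  proof -
    have x: "0 < x" "x < T" and y: "0 < y" "y < T" using that by (auto simp: G_def)
    have "AE t in lborel. t \<in> {0<..<T} \<longrightarrow>
      (\<forall>n. \<bar>t - x\<bar> < d n \<longrightarrow> norm (v t - v x) \<le> 1 / real (Suc n)) \<and>
      (\<forall>n. \<bar>t - y\<bar> < d n \<longrightarrow> norm (v t - v y) \<le> 1 / real (Suc n))"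
    proof -
      have "good x" "good y" using that(1,2) by (auto simp: G_def)
      then show ?thesis unfolding good_def by eventually_elim blast
    qed
    from AE_lborel_interval_ex[OF this that(3)] obtain t where "x < t" "t < y"
      and t: "t \<in> {0<..<T} \<longrightarrow> (\<forall>n. \<bar>t - x\<bar> < d n \<longrightarrow> norm (v t - v x) \<le> 1 / real (Suc n)) \<and>
      (\<forall>n. \<bar>t - y\<bar> < d n \<longrightarrow> norm (v t - v y) \<le> 1 / real (Suc n))" by blast
    have "t \<in> {0<..<T}" "\<bar>t - x\<bar> < d n" "\<bar>t - y\<bar> < d n"
      using \<open>x < t\<close> \<open>t < y\<close> x y that(4) by auto
    with t have "norm (v t - v x) \<le> 1 / real (Suc n)" "norm (v t - v y) \<le> 1 / real (Suc n)" by blast+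
    moreover have "norm (v y - v x) \<le> norm (v y - v t) + norm (v t - v x)"
      using norm_triangle_ineq[of "v y - v t" "v t - v x"] by simp
    moreover have "2 / real (Suc n) = 1 / real (Suc n) + 1 / real (Suc n)" by (simp add: add_divide_distrib)
    ultimately show ?thesis by (simp add: norm_minus_commute)
  qed
  have "uniformly_continuous_on G v"
    unfolding uniformly_continuous_on_def
  proof (intro allI impI)
    fix e :: real assume "0 < e"
    then obtain n where "1 / real (Suc n) < e / 2" using nat_approx_posE[of "e / 2"] by auto
    then have n: "2 / real (Suc n) < e" by (simp add: field_simps)
    show "\<exists>c>0. \<forall>x\<in>G. \<forall>x'\<in>G. dist x' x < c \<longrightarrow> dist (v x') (v x) < e"
    proof (intro exI[of _ "d n"] conjI ballI impI d)
      fix x x' assume xx: "x \<in> G" "x' \<in> G" "dist x' x < d n"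
      consider "x < x'" | "x' < x" | "x = x'" by linarith
      then show "dist (v x') (v x) < e"
      proof cases
        case 1
        with close[of x x' n] xx n show ?thesis by (auto simp: dist_real_def dist_norm)
      next
        case 2
        with close[of x' x n] xx n show ?thesis by (auto simp: dist_real_def dist_norm norm_minus_commute)
      next
        case 3
        with \<open>0 < e\<close> show ?thesis by simp
      qed
    qed
  qed
  \<comment> \<open>Completeness of the target space enters here, in extending a uniformly
    continuous function from a dense set.\<close>
  then obtain w where w: "uniformly_continuous_on (closure G) w" "\<And>x. x \<in> G \<Longrightarrow> v x = w x"
    by (rule uniformly_continuous_on_extension_on_closure) blast
  show thesis
  proof (rule that)
    show "continuous_on {0..T} w" using uniformly_continuous_imp_continuous[OF w(1)] by (simp only: cl)
    show "AE t in lborel. t \<in> {0<..<T} \<longrightarrow> v t = w t"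
      using AE_good by eventually_elim (auto simp: G_def intro!: w(2))
  qed
qed

text \<open>By equicontinuity any sample on a fine cell represents the whole cell; the choice of the
  shift only has to keep \<open>u\<close> small at the samples, which places them in a compact set
  common to all \<open>n\<close>.\<close>

lemma uniform_sampling:
  fixes w :: "nat \<Rightarrow> real \<Rightarrow> 'b::real_normed_vector" and u :: "nat \<Rightarrow> real \<Rightarrow> ennreal"
  assumes T: "0 < T" and u: "\<And>n. u n \<in> borel_measurable borel"
    and le_u: "\<And>n. (\<integral>\<^sup>+t. indicator {0<..<T} t * u n t \<partial>lborel) \<le> ennreal C"
    and cpt: "\<And>R. \<exists>K. compact K \<and>
      (\<forall>n. AE t in lborel. t \<in> {0<..<T} \<longrightarrow> u n t \<le> ennreal R \<longrightarrow> w n t \<in> K)"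
    and equi: "\<exists>d>0. \<forall>n. \<forall>t\<in>{0..T}. \<forall>\<tau>\<in>{0..T}. \<bar>t - \<tau>\<bar> < d \<longrightarrow> norm (w n t - w n \<tau>) \<le> \<epsilon>"
  shows "\<exists>\<delta> N K a. 0 < \<delta> \<and> real N * \<delta> = T \<and> compact K \<and> (\<forall>n k. a n k \<in> K) \<and>
    (\<forall>n. \<forall>k<N. \<forall>t\<in>{real k * \<delta>..real k * \<delta> + \<delta>}. norm (w n t - a n k) \<le> \<epsilon>)"
proof -
  obtain d where d: "0 < d" "\<And>n t \<tau>. t \<in> {0..T} \<Longrightarrow> \<tau> \<in> {0..T} \<Longrightarrow> \<bar>t - \<tau>\<bar> < d \<Longrightarrow> norm (w n t - w n \<tau>) \<le> \<epsilon>"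
    using equi by blast
  obtain N \<delta> where N0: "0 < N" and \<delta>: "0 < \<delta>" "\<delta> < d" and T_eq: "real N * \<delta> = T"
    using fine_partition[OF T d(1)] .
  \<comment> \<open>The selection of the shift divides by the bound on the integral of
    \<open>u\<close>, so this bound is made positive.\<close>
  define C' where "C' = max C 1"
  have C': "0 < C'" by (simp add: C'_def)
  obtain K where K: "compact K"
    "\<And>n. AE t in lborel. t \<in> {0<..<T} \<longrightarrow> u n t \<le> ennreal (4 * C' / \<delta>) \<longrightarrow> w n t \<in> K"
    using cpt by blast
  have "\<exists>a. (\<forall>k. a k \<in> K) \<and>
    (\<forall>k<N. \<forall>t\<in>{real k * \<delta>..real k * \<delta> + \<delta>}. norm (w n t - a k) \<le> \<epsilon>)" for n
  proof -
    have le_C': "(\<integral>\<^sup>+t. indicator {0<..<real N * \<delta>} t * u n t \<partial>lborel) \<le> ennreal C'"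
      unfolding T_eq using le_u by (rule order_trans) (simp add: C'_def ennreal_leI)
    obtain s where s: "0 < s" "s < \<delta>"
      "\<And>k. k < N \<Longrightarrow> u n (s + real k * \<delta>) \<le> ennreal (4 * C' / \<delta>) \<longrightarrow> w n (s + real k * \<delta>) \<in> K"
      "\<And>k. k < N \<Longrightarrow> u n (s + real k * \<delta>) \<le> ennreal (4 * C' / \<delta>)"
    \<comment> \<open>With kernel 0 the closeness demand is vacuous; the value 1 taken for
      \<open>\<eta>\<close> is arbitrary, as the bound on \<open>u\<close> is independent of
      it.\<close>
    proof (rule good_translate_slices[where K = "\<lambda>_. 0", OF _ _ u \<delta>(1) zero_less_one C' le_C' _ K(2)[of n, folded T_eq]])
    qed auto
    \<comment> \<open>Indices beyond the last cell repeat the sample of cell 0, so that the entire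
      sequence stays in \<open>K\<close>, as the extraction of limits requires.\<close>
    define a where "a k = w n (s + real (if k < N then k else 0) * \<delta>)" for k
    have "a k \<in> K" for k using s(3,4)[of "if k < N then k else 0"] N0 by (auto simp: a_def)
    moreover have "norm (w n t - a k) \<le> \<epsilon>" if k: "k < N" and t: "t \<in> {real k * \<delta>..real k * \<delta> + \<delta>}" for k t
    proof -
      have "real (Suc k) * \<delta> \<le> real N * \<delta>" using k \<delta>(1) by (intro mult_right_mono) auto
      then have "real k * \<delta> + \<delta> \<le> T" unfolding T_eq by (simp add: algebra_simps)
      moreover have "0 \<le> real k * \<delta>" using \<delta>(1) by (intro mult_nonneg_nonneg) auto
      ultimately have "t \<in> {0..T}" "s + real k * \<delta> \<in> {0..T}" "\<bar>t - (s + real k * \<delta>)\<bar> < d"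
        using t s(1,2) \<delta> unfolding atLeastAtMost_iff by linarith+
      from d(2)[OF this] show ?thesis using k by (simp add: a_def)
    qed
    ultimately show ?thesis by blast
  qed
  then obtain a where "\<And>n k. a n k \<in> K"
    "\<And>n k t. k < N \<Longrightarrow> t \<in> {real k * \<delta>..real k * \<delta> + \<delta>} \<Longrightarrow> norm (w n t - a n k) \<le> \<epsilon>"
    by metis
  then show ?thesis using \<delta>(1) T_eq K(1)
    by (intro exI[of _ \<delta>] exI[of _ N] exI[of _ K] exI[of _ a]) simp
qed

text \<open>After extraction the finitely many samples of each level converge. Two late members of
  the subsequence are then close on every cell, because both are close there to samples with the
  same limit.\<close>

lemma uniform_limit_subsequence:
  fixes w :: "nat \<Rightarrow> real \<Rightarrow> 'b::banach" and u :: "nat \<Rightarrow> real \<Rightarrow> ennreal"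
  assumes T: "0 < T" and cont: "\<And>n. continuous_on {0..T} (w n)"
    and u: "\<And>n. u n \<in> borel_measurable borel"
    and le_u: "\<And>n. (\<integral>\<^sup>+t. indicator {0<..<T} t * u n t \<partial>lborel) \<le> ennreal C"
    and cpt: "\<And>R. \<exists>K. compact K \<and>
      (\<forall>n. AE t in lborel. t \<in> {0<..<T} \<longrightarrow> u n t \<le> ennreal R \<longrightarrow> w n t \<in> K)"
    and equi: "\<And>\<epsilon>. 0 < \<epsilon> \<Longrightarrow> \<exists>d>0. \<forall>n. \<forall>t\<in>{0..T}. \<forall>\<tau>\<in>{0..T}. \<bar>t - \<tau>\<bar> < d \<longrightarrow> norm (w n t - w n \<tau>) \<le> \<epsilon>"
  obtains \<phi> g where "strict_mono \<phi>" "continuous_on {0..T} g"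
    "uniform_limit {0..T} (\<lambda>n. w (\<phi> n)) g sequentially"
proof -
  define approx where "approx m \<delta> N K a \<longleftrightarrow>
    0 < \<delta> \<and> real N * \<delta> = T \<and> compact K \<and> (\<forall>n k. a n k \<in> K) \<and>
    (\<forall>n. \<forall>k<N. \<forall>t\<in>{real k * \<delta>..real k * \<delta> + \<delta>}. norm (w n t - a n k) \<le> 1 / real (Suc m))"
    for m \<delta> N K a
  have "\<exists>\<delta> N K a. approx m \<delta> N K a" for m
    unfolding approx_def by (rule uniform_sampling[OF T u le_u cpt equi]) simp
  then obtain \<delta> N K a where "\<And>m. approx m (\<delta> m) (N m) (K m) (a m)" by metis
  then have \<delta>: "\<And>m. 0 < \<delta> m" and T_eq: "\<And>m. real (N m) * \<delta> m = T"
    and K: "\<And>m. compact (K m)" "\<And>m n k. a m n k \<in> K m"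
    and near: "\<And>m n k t. k < N m \<Longrightarrow> t \<in> {real k * \<delta> m..real k * \<delta> m + \<delta> m} \<Longrightarrow>
      norm (w n t - a m n k) \<le> 1 / real (Suc m)"
    by (simp_all add: approx_def)
  obtain \<phi> l where \<phi>: "strict_mono \<phi>" and l: "\<And>m k. (\<lambda>n. a m (\<phi> n) k) \<longlonglongrightarrow> l m k"
    using compact_double_subsequence[of K "\<lambda>n m k. a m n k", OF K] by blast
  \<comment> \<open>\<open>cell\<close> covers only the open interval; taking closed cells assigns 0
    to the first one and \<open>T\<close> to the last one.\<close>
  have ex_cell: "\<exists>k<N m. t \<in> {real k * \<delta> m..real k * \<delta> m + \<delta> m}" if "t \<in> {0..T}" for t m
  proof -
    have "0 < N m" using T_eq[of m] T by (cases "N m") auto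
    then have last: "real (N m - 1) * \<delta> m + \<delta> m = T" using T_eq[of m] by (simp add: of_nat_diff algebra_simps)
    have "t = 0 \<or> t = T \<or> t \<in> {0<..<real (N m) * \<delta> m}"
      unfolding T_eq using that by auto
    then consider "t = 0" | "t = T" | "t \<in> {0<..<real (N m) * \<delta> m}" by blast
    then show ?thesis
    proof cases
      case 1
      then show ?thesis using \<open>0 < N m\<close> \<delta>[of m] by (intro exI[of _ 0]) auto
    next
      case 2
      then show ?thesis using \<open>0 < N m\<close> \<delta>[of m] last
        by (intro exI[of _ "N m - 1"]) auto
    next
      case 3
      from cell_bounds[OF \<delta> this] show ?thesis by (intro exI[of _ "cell (\<delta> m) (N m) t"]) auto
    qed
  qed
  have "uniformly_Cauchy_on {0..T} (\<lambda>n. w (\<phi> n))"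
  proof (rule uniformly_Cauchy_onI)
    fix e :: real assume "0 < e"
    \<comment> \<open>The distance is split into four parts: for each of the two functions, its
      distance to the sample and the distance of the sample to its limit.\<close>
    then obtain m where m: "1 / real (Suc m) < e / 4" using nat_approx_posE[of "e / 4"] by auto
    have "\<forall>\<^sub>F n in sequentially. \<forall>k\<in>{..<N m}. dist (a m (\<phi> n) k) (l m k) < e / 4"
      using \<open>0 < e\<close> by (intro eventually_ball_finite finite_lessThan ballI tendstoD[OF l]) simp
    then obtain M where M: "\<And>n k. M \<le> n \<Longrightarrow> k < N m \<Longrightarrow> dist (a m (\<phi> n) k) (l m k) < e / 4"
      by (auto simp: eventually_sequentially)
    show "\<exists>M. \<forall>x\<in>{0..T}. \<forall>i\<ge>M. \<forall>j\<ge>M. dist (w (\<phi> i) x) (w (\<phi> j) x) < e"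
    proof (intro exI[of _ M] ballI allI impI)
      fix t i j assume "t \<in> {0..T}" and ij: "M \<le> i" "M \<le> j"
      then obtain k where k: "k < N m" "t \<in> {real k * \<delta> m..real k * \<delta> m + \<delta> m}"
        using ex_cell by blast
      have "dist (w (\<phi> i) t) (a m (\<phi> i) k) < e / 4" "dist (w (\<phi> j) t) (a m (\<phi> j) k) < e / 4"
        using near[OF k, of "\<phi> i"] near[OF k, of "\<phi> j"] m by (simp_all add: dist_norm)
      moreover have "dist (a m (\<phi> i) k) (l m k) < e / 4" "dist (a m (\<phi> j) k) (l m k) < e / 4"
        using M ij k(1) by blast+
      ultimately show "dist (w (\<phi> i) t) (w (\<phi> j) t) < e"
        using dist_triangle[of "w (\<phi> i) t" "l m k" "a m (\<phi> i) k"]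
          dist_triangle[of "w (\<phi> j) t" "l m k" "a m (\<phi> j) k"]
          dist_triangle2[of "w (\<phi> i) t" "w (\<phi> j) t" "l m k"]
        by linarith
    qed
  qed
  then obtain g where g: "uniform_limit {0..T} (\<lambda>n. w (\<phi> n)) g sequentially"
    using Cauchy_uniformly_convergent uniformly_convergent_on_def by blast
  have "continuous_on {0..T} g"
    by (rule uniform_limit_theorem[OF _ g]) (auto simp: cont)
  with \<phi> show thesis using g by (rule that)
qed

subsection \<open>The case \<open>p < \<infinity>\<close>\<close>

lemma powr_dist_triangle:
  fixes x y z :: "'a::real_normed_vector"
  assumes "0 \<le> q"
  shows "norm (x - y) powr q \<le> 2 powr q * (norm (x - z) powr q + norm (z - y) powr q)"
proof -
  define M where "M = max (norm (x - z)) (norm (z - y))"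
  have "norm (x - y) \<le> norm (x - z) + norm (z - y)"
    using norm_triangle_ineq[of "x - z" "z - y"] by simp
  then have "norm (x - y) \<le> 2 * M" unfolding M_def by linarith
  then have "norm (x - y) powr q \<le> (2 * M) powr q" using assms by (intro powr_mono2) auto
  also have "\<dots> = 2 powr q * M powr q" by (simp add: M_def powr_mult)
  also have "M powr q \<le> norm (x - z) powr q + norm (z - y) powr q" by (simp add: M_def max_def)
  finally show ?thesis by simp
qed

lemma power_integral_triangle:
  assumes [simp]: "strong_borel f" "strong_borel g" "strong_borel h"
    and [measurable]: "S \<in> sets borel" and "0 \<le> q"
  shows "power_integral q S (\<lambda>t. f t - g t) \<le>
    ennreal (2 powr q) * (power_integral q S (\<lambda>t. f t - h t) + power_integral q S (\<lambda>t. h t - g t))"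
proof -
  have [measurable]: "(\<lambda>t. norm (f t - h t)) \<in> borel_measurable borel"
    "(\<lambda>t. norm (h t - g t)) \<in> borel_measurable borel"
    by (rule strong_borel_norm_diff_compose; simp)+
  have "power_integral q S (\<lambda>t. f t - g t) \<le> (\<integral>\<^sup>+t. ennreal (2 powr q) *
    (indicator S t * ennreal (norm (f t - h t) powr q) + indicator S t * ennreal (norm (h t - g t) powr q)) \<partial>lborel)"
    unfolding power_integral_def
  proof (rule nn_integral_mono)
    fix t
    have "ennreal (norm (f t - g t) powr q) \<le> ennreal (2 powr q * (norm (f t - h t) powr q + norm (h t - g t) powr q))"
      using powr_dist_triangle[OF assms(5)] by (rule ennreal_leI)
    also have "\<dots> = ennreal (2 powr q) * (ennreal (norm (f t - h t) powr q) + ennreal (norm (h t - g t) powr q))"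
      by (simp add: ennreal_mult)
    finally show "indicator S t * ennreal (norm (f t - g t) powr q) \<le> ennreal (2 powr q) *
      (indicator S t * ennreal (norm (f t - h t) powr q) + indicator S t * ennreal (norm (h t - g t) powr q))"
      by (auto simp: indicator_def)
  qed
  also have "\<dots> = ennreal (2 powr q) * (power_integral q S (\<lambda>t. f t - h t) + power_integral q S (\<lambda>t. h t - g t))"
    unfolding power_integral_def by (simp add: nn_integral_cmult nn_integral_add)
  finally show ?thesis .
qed

text \<open>Fatou's lemma. The condition \<open>0 < q\<close> gives continuity of the power also
  where the limiting norm is 0.\<close>

lemma power_integral_le_of_limit:
  fixes F G :: "nat \<Rightarrow> real \<Rightarrow> 'a::real_normed_vector"
  assumes [simp]: "\<And>n. strong_borel (F n)" "\<And>n. strong_borel (G n)"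
    and [measurable]: "S \<in> sets borel" and "0 < q"
    and lim: "AE t in lborel. t \<in> S \<longrightarrow> (\<lambda>n. F n t - G n t) \<longlonglongrightarrow> D t"
    and le: "\<forall>\<^sub>F n in sequentially. power_integral q S (\<lambda>t. F n t - G n t) \<le> B"
  shows "power_integral q S D \<le> B"
proof -
  have [measurable]: "(\<lambda>t. norm (F n t - G n t)) \<in> borel_measurable borel" for n
    by (rule strong_borel_norm_diff_compose) simp_all
  have "power_integral q S D
    = (\<integral>\<^sup>+t. liminf (\<lambda>n. indicator S t * ennreal (norm (F n t - G n t) powr q)) \<partial>lborel)"
    unfolding power_integral_def
  proof (rule nn_integral_cong_AE)
    show "AE t in lborel. indicator S t * ennreal (norm (D t) powr q)
      = liminf (\<lambda>n. indicator S t * ennreal (norm (F n t - G n t) powr q))"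
      using lim
    proof eventually_elim
      case (elim t)
      have "(\<lambda>n. indicator S t * ennreal (norm (F n t - G n t) powr q))
        \<longlonglongrightarrow> indicator S t * ennreal (norm (D t) powr q)"
      proof (cases "t \<in> S")
        case True
        then have "(\<lambda>n. norm (F n t - G n t) powr q) \<longlonglongrightarrow> norm (D t) powr q"
          using elim assms(4) by (intro tendsto_powr' tendsto_norm tendsto_const) auto
        then show ?thesis using True by (simp add: tendsto_ennrealI)
      qed simp
      then show ?case by (simp add: lim_imp_Liminf)
    qed
  qed
  also have "\<dots> \<le> liminf (\<lambda>n. power_integral q S (\<lambda>t. F n t - G n t))"
    unfolding power_integral_def by (rule nn_integral_liminf) measurable
  also have "\<dots> \<le> B" using le by (intro Liminf_le) auto
  finally show ?thesis .
qed

lemma simple_limit_strongly_measurable_on: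
  assumes g: "\<And>n::nat. simple_function borel (g n)" and S: "S \<in> sets lebesgue"
    and lim: "AE t in lborel. t \<in> S \<longrightarrow> (\<lambda>n. g n t) \<longlonglongrightarrow> f t"
  shows "strongly_measurable_on S f"
  unfolding strongly_measurable_on_def
proof (intro exI[of _ g] conjI allI)
  fix n y
  show "finite (g n ` S)"
    using simple_functionD(1)[OF g[of n]] by (rule finite_subset[rotated]) auto
  have "g n -` {y} \<in> sets borel" using simple_functionD(2)[OF g[of n], of "{y}"] by simp
  then have "g n -` {y} \<in> sets lebesgue" by simp
  then have "S \<inter> g n -` {y} \<in> sets lebesgue" using S by blast
  then show "{t \<in> S. g n t = y} \<in> sets lebesgue" by (simp add: vimage_def Int_def)
qed (use lim in \<open>simp add: AE_completion_iff\<close>)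

lemma strong_borel_imp_strongly_measurable_on:
  assumes "strong_borel f" "S \<in> sets lebesgue"
  shows "strongly_measurable_on S f"
proof -
  obtain g where g: "\<And>n::nat. simple_function borel (g n)" "\<And>t. (\<lambda>n. g n t) \<longlonglongrightarrow> f t"
    using assms(1) unfolding strong_borel_def by auto
  show ?thesis
    by (rule simple_limit_strongly_measurable_on[of g, OF g(1) assms(2)]) (simp add: g(2))
qed

text \<open>\<open>lim\<close> has an unspecified value where the sequence diverges; passing through
  \<open>strongly_measurable_on\<close> and back replaces it by a Borel version whose approximation
  holds everywhere.\<close>

lemma simple_limit_strong_borel:
  assumes "\<And>m::nat. simple_function borel (\<sigma> m)" "S \<in> sets borel"
    and "AE t in lborel. t \<in> S \<longrightarrow> convergent (\<lambda>m. \<sigma> m t)"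
  obtains w where "strong_borel w" "AE t in lborel. t \<in> S \<longrightarrow> (\<lambda>m. \<sigma> m t) \<longlonglongrightarrow> w t"
proof -
  have S: "S \<in> sets lebesgue" using assms(2) by simp
  have lim: "AE t in lborel. t \<in> S \<longrightarrow> (\<lambda>m. \<sigma> m t) \<longlonglongrightarrow> lim (\<lambda>m. \<sigma> m t)"
    using assms(3) by eventually_elim (auto simp: convergent_LIMSEQ_iff)
  have "strongly_measurable_on S (\<lambda>t. lim (\<lambda>m. \<sigma> m t))"
    using assms(1) S lim by (rule simple_limit_strongly_measurable_on)
  then obtain w where w: "strong_borel w" "AE t in lborel. t \<in> S \<longrightarrow> lim (\<lambda>m. \<sigma> m t) = w t"
    using strongly_measurable_on_imp_strong_borel[OF _ S] by blast
  have "AE t in lborel. t \<in> S \<longrightarrow> (\<lambda>m. \<sigma> m t) \<longlonglongrightarrow> w t"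
    using lim w(2) by eventually_elim auto
  with w(1) show thesis by (rule that)
qed

text \<open>The Riesz-Fischer argument with a prescribed rate: the rate makes the increments
  summable at almost every point, and Fatou's lemma bounds the distance to the pointwise
  limit.\<close>

lemma power_integral_complete:
  fixes \<sigma> :: "nat \<Rightarrow> real \<Rightarrow> 'a::banach"
  assumes \<sigma>: "\<And>m. simple_function borel (\<sigma> m)" and S [measurable]: "S \<in> sets borel" and q: "1 \<le> q"
    and le: "\<And>m k. power_integral q S (\<lambda>t. \<sigma> m t - \<sigma> k t)
      \<le> ennreal (((1/4) ^ m) powr q + ((1/4) ^ k) powr q)"
  obtains w where "strong_borel w"
    "\<And>m. power_integral q S (\<lambda>t. \<sigma> m t - w t) \<le> ennreal (2 * ((1/4) ^ m) powr q)"
proof -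
  have sb [simp]: "strong_borel (\<sigma> m)" for m using \<sigma> by (rule simple_imp_strong_borel)
  have [measurable]: "(\<lambda>t. norm (\<sigma> m t - \<sigma> k t)) \<in> borel_measurable borel" for m k
    by (rule strong_borel_norm_diff_compose) simp_all
  \<comment> \<open>The factor \<open>2 ^ m\<close> is chosen between the rate \<open>4 ^ m\<close>
    and 1: the integrals of \<open>d m\<close> remain geometrically summable, while
    \<open>d m t < 1\<close> forces the m-th increment at \<open>t\<close> below
    \<open>(1/2) ^ m\<close>.\<close>
  define d where "d m t = (2 ^ m * norm (\<sigma> (Suc m) t - \<sigma> m t)) powr q" for m t
  have [measurable]: "d m \<in> borel_measurable borel" for m unfolding d_def by measurable
  have d_le: "(\<integral>\<^sup>+t. indicator S t * ennreal (d m t) \<partial>lborel) \<le> ennreal (2 * (1/2) ^ m)" for m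
  proof -
    have "(\<integral>\<^sup>+t. indicator S t * ennreal (d m t) \<partial>lborel)
      = (\<integral>\<^sup>+t. ennreal ((2 ^ m) powr q) * (indicator S t * ennreal (norm (\<sigma> (Suc m) t - \<sigma> m t) powr q)) \<partial>lborel)"
      by (simp add: d_def powr_mult ennreal_mult mult.left_commute)
    also have "\<dots> = ennreal ((2 ^ m) powr q) * power_integral q S (\<lambda>t. \<sigma> (Suc m) t - \<sigma> m t)"
      unfolding power_integral_def by (rule nn_integral_cmult) measurable
    also have "\<dots> \<le> ennreal ((2 ^ m) powr q) * ennreal (((1/4) ^ Suc m) powr q + ((1/4) ^ m) powr q)"
      by (intro mult_left_mono le) simp
    also have "\<dots> \<le> ennreal ((2 ^ m) powr q) * ennreal (((1/4) ^ m) powr q + ((1/4) ^ m) powr q)"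
      using q by (intro mult_left_mono ennreal_leI add_mono powr_mono2) auto
    also have "\<dots> = ennreal (2 * ((2 ^ m * (1/4) ^ m) powr q))"
      by (subst ennreal_mult[symmetric]) (auto simp: powr_mult)
    also have "2 ^ m * (1/4) ^ m = ((1/2) ^ m :: real)"
      by (simp flip: power_mult_distrib)
    \<comment> \<open>As \<open>q \<ge> 1\<close>, raising a number between 0 and 1 to the power
      \<open>q\<close> does not increase it; this removes \<open>q\<close> from the series.\<close>
    also have "ennreal (2 * ((1/2) ^ m) powr q) \<le> ennreal (2 * (1/2) ^ m)"
      using q powr_le_one_le[of "(1/2) ^ m" q] by (intro ennreal_leI mult_left_mono) (auto simp: power_le_one)
    finally show ?thesis .
  qed
  have "(\<integral>\<^sup>+t. (\<Sum>m. indicator S t * ennreal (d m t)) \<partial>lborel)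
    = (\<Sum>m. \<integral>\<^sup>+t. indicator S t * ennreal (d m t) \<partial>lborel)"
    by (rule nn_integral_suminf) measurable
  also have "\<dots> \<le> (\<Sum>m. ennreal (2 * (1/2) ^ m))"
    by (intro suminf_le d_le) auto
  also have "\<dots> = ennreal (2 * 2)"
  proof (rule suminf_ennreal_eq)
    show "(\<lambda>m. 2 * (1/2) ^ m :: real) sums (2 * 2)"
      using sums_mult[OF geometric_sums[of "1/2 :: real"], of 2] by simp
  qed simp
  finally have "(\<integral>\<^sup>+t. (\<Sum>m. indicator S t * ennreal (d m t)) \<partial>lborel) \<noteq> \<infinity>"
    by (auto simp: top_unique)
  then have fin: "AE t in lborel. (\<Sum>m. indicator S t * ennreal (d m t)) \<noteq> \<infinity>"
    by (rule nn_integral_PInf_AE[rotated]) measurable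
  have "AE t in lborel. t \<in> S \<longrightarrow> convergent (\<lambda>m. \<sigma> m t)"
    using fin
  proof (eventually_elim, intro impI)
    fix t assume fin: "(\<Sum>m. indicator S t * ennreal (d m t)) \<noteq> \<infinity>" and "t \<in> S"
    then have "(\<Sum>m. ennreal (d m t)) \<noteq> top" by simp
    then have "summable (\<lambda>m. d m t)" by (intro summable_suminf_not_top) (auto simp: d_def)
    then have "(\<lambda>m. d m t) \<longlonglongrightarrow> 0" by (rule summable_LIMSEQ_zero)
    then have "\<forall>\<^sub>F m in sequentially. d m t < 1" by (rule order_tendstoD) simp
    then have "\<forall>\<^sub>F m in sequentially. norm (\<sigma> (Suc m) t - \<sigma> m t) \<le> (1/2) ^ m"
    proof eventually_elim
      case (elim m)
      have "2 ^ m * norm (\<sigma> (Suc m) t - \<sigma> m t) \<le> 1"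
      proof (rule ccontr)
        assume "\<not> ?thesis"
        then have "1 \<le> d m t" unfolding d_def using q by (intro ge_one_powr_ge_zero) auto
        with elim show False by simp
      qed
      then show ?case by (simp add: field_simps)
    qed
    then have "summable (\<lambda>m. \<sigma> (Suc m) t - \<sigma> m t)"
      by (rule summable_comparison_test_ev) (simp add: summable_geometric)
    then have "convergent (\<lambda>n. \<Sum>m<n. \<sigma> (Suc m) t - \<sigma> m t)"
      by (simp add: summable_iff_convergent)
    then have "convergent (\<lambda>n. \<sigma> n t - \<sigma> 0 t)"
      by (simp only: sum_lessThan_telescope[of "\<lambda>n. \<sigma> n t"])
    then show "convergent (\<lambda>m. \<sigma> m t)" by (simp add: convergent_diff_const_right_iff)
  qed
  with \<sigma> S obtain w where w: "strong_borel w" "AE t in lborel. t \<in> S \<longrightarrow> (\<lambda>m. \<sigma> m t) \<longlonglongrightarrow> w t"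
    by (rule simple_limit_strong_borel)
  show thesis
  proof (rule that[OF w(1)])
    fix m
    show "power_integral q S (\<lambda>t. \<sigma> m t - w t) \<le> ennreal (2 * ((1/4) ^ m) powr q)"
    proof (rule power_integral_le_of_limit[of "\<lambda>_. \<sigma> m" \<sigma>])
      show "AE t in lborel. t \<in> S \<longrightarrow> (\<lambda>k. \<sigma> m t - \<sigma> k t) \<longlonglongrightarrow> \<sigma> m t - w t"
        using w(2) by eventually_elim (auto intro!: tendsto_diff)
      have "power_integral q S (\<lambda>t. \<sigma> m t - \<sigma> k t) \<le> ennreal (2 * ((1/4) ^ m) powr q)" if "m \<le> k" for k
      proof -
        have "((1/4) ^ k) powr q \<le> ((1/4 :: real) ^ m) powr q"
          using that q by (intro powr_mono2 power_decreasing) auto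
        then show ?thesis by (intro order_trans[OF le] ennreal_leI) simp
      qed
      then show "\<forall>\<^sub>F k in sequentially. power_integral q S (\<lambda>t. \<sigma> m t - \<sigma> k t) \<le> ennreal (2 * ((1/4) ^ m) powr q)"
        unfolding eventually_sequentially by blast
    qed (use q in auto)
  qed
qed

section \<open>Convergence of the step approximations along a subsequence\<close>

lemma power_integral_minus_commute:
  "power_integral q S (\<lambda>t. f t - g t) = power_integral q S (\<lambda>t. g t - f t)"
  by (simp add: power_integral_def norm_minus_commute)

lemma step_fun_tendsto:
  assumes "\<And>k. (\<lambda>n. a n k) \<longlonglongrightarrow> l k"
  shows "(\<lambda>n. step_fun \<delta> N (a n) t) \<longlonglongrightarrow> step_fun \<delta> N l t"
  using assms by (simp add: step_fun_def)

text \<open>Bounding the difference on each cell by the sum over all cells is crude, but it suffices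
  because \<open>N\<close> is fixed while the coefficients converge.\<close>

lemma power_integral_step_fun_diff_le:
  assumes "0 < \<delta>" "0 \<le> q"
  shows "power_integral q {0<..<real N * \<delta>} (\<lambda>t. step_fun \<delta> N a t - step_fun \<delta> N b t)
    \<le> ennreal (real N * \<delta> * (\<Sum>k<N. norm (a k - b k)) powr q)"
proof -
  have "power_integral q {0<..<real N * \<delta>} (\<lambda>t. step_fun \<delta> N a t - step_fun \<delta> N b t)
    \<le> (\<integral>\<^sup>+t. indicator {0<..<real N * \<delta>} t * ennreal ((\<Sum>k<N. norm (a k - b k)) powr q) \<partial>lborel)"
    unfolding power_integral_def
  proof (intro nn_integral_mono mult_left_mono ennreal_leI powr_mono2)
    fix t
    show "norm (step_fun \<delta> N a t - step_fun \<delta> N b t) \<le> (\<Sum>k<N. norm (a k - b k))"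
      using member_le_sum[of "cell \<delta> N t" "{..<N}" "\<lambda>k. norm (a k - b k)"]
      by (auto simp: step_fun_def sum_nonneg)
  qed (use assms in auto)
  also have "\<dots> = ennreal (real N * \<delta> * (\<Sum>k<N. norm (a k - b k)) powr q)"
    using assms by (subst nn_integral_multc) (auto simp: ennreal_mult)
  finally show ?thesis .
qed

text \<open>The shift depends on \<open>n\<close>, yet \<open>\<delta>\<close>, \<open>N\<close> and
  the bound on the sampled \<open>u\<close> do not; therefore one compact \<open>K\<close> contains
  the values of all the step functions.\<close>

lemma uniform_step_approximation:
  fixes v :: "nat \<Rightarrow> real \<Rightarrow> 'b::real_normed_vector" and u :: "nat \<Rightarrow> real \<Rightarrow> ennreal"
  assumes T: "0 < T" and v: "\<And>n. strong_borel (v n)" and u: "\<And>n. u n \<in> borel_measurable borel"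
    and le_u: "\<And>n. (\<integral>\<^sup>+t. indicator {0<..<T} t * u n t \<partial>lborel) \<le> ennreal C"
    and cpt: "\<And>R. \<exists>K. compact K \<and>
      (\<forall>n. AE t in lborel. t \<in> {0<..<T} \<longrightarrow> u n t \<le> ennreal R \<longrightarrow> v n t \<in> K)"
    and transl: "\<exists>d>0. \<forall>h. 0 < h \<and> h < d \<longrightarrow>
      (\<forall>n. power_integral q {0<..<T - h} (\<lambda>t. v n (t + h) - v n t) \<le> ennreal \<eta>)"
    and \<eta>: "0 < \<eta>"
  shows "\<exists>\<delta> N K a. 0 < \<delta> \<and> real N * \<delta> = T \<and> compact K \<and> (\<forall>n k. a n k \<in> K) \<and>
    (\<forall>n. power_integral q {0<..<T} (\<lambda>t. v n t - step_fun \<delta> N (a n) t) \<le> ennreal (4 * \<eta>))"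
proof -
  obtain d where d: "0 < d" "\<And>h n. 0 < h \<Longrightarrow> h < d \<Longrightarrow>
      power_integral q {0<..<T - h} (\<lambda>t. v n (t + h) - v n t) \<le> ennreal \<eta>"
    using transl by blast
  obtain N \<delta> where N0: "0 < N" and \<delta>: "0 < \<delta>" "\<delta> < d" and T_eq: "real N * \<delta> = T"
    using fine_partition[OF T d(1)] .
  define C' where "C' = max C 1"
  have C': "0 < C'" by (simp add: C'_def)
  obtain K where K: "compact K"
    "\<And>n. AE t in lborel. t \<in> {0<..<T} \<longrightarrow> u n t \<le> ennreal (4 * C' / \<delta>) \<longrightarrow> v n t \<in> K"
    using cpt by blast
  have "\<exists>a. (\<forall>k. a k \<in> K) \<and>
    power_integral q {0<..<T} (\<lambda>t. v n t - step_fun \<delta> N a t) \<le> ennreal (4 * \<eta>)" for n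
  proof -
    have le_C': "(\<integral>\<^sup>+t. indicator {0<..<real N * \<delta>} t * u n t \<partial>lborel) \<le> ennreal C'"
      unfolding T_eq using le_u by (rule order_trans) (simp add: C'_def ennreal_leI)
    have le_h: "power_integral q {0<..<real N * \<delta> - h} (\<lambda>t. v n (t + h) - v n t) \<le> ennreal \<eta>"
      if "0 < h" "h < \<delta>" for h
      unfolding T_eq using that \<delta>(2) by (intro d(2)) auto
    obtain s where s: "0 < s" "s < \<delta>"
      "\<And>k. k < N \<Longrightarrow> u n (s + real k * \<delta>) \<le> ennreal (4 * C' / \<delta>) \<longrightarrow> v n (s + real k * \<delta>) \<in> K"
      "\<And>k. k < N \<Longrightarrow> u n (s + real k * \<delta>) \<le> ennreal (4 * C' / \<delta>)"
      "power_integral q {0<..<real N * \<delta>} (\<lambda>t. v n t - step_fun \<delta> N (\<lambda>k. v n (s + real k * \<delta>)) t)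
        \<le> ennreal (4 * \<eta>)"
      using step_fun_approximation[OF v u \<delta>(1) \<eta> C' le_C' le_h K(2)[of n, folded T_eq]] by blast
    \<comment> \<open>Values beyond the last cell do not affect the step function; they are filled
      with the sample of cell 0 to remain in \<open>K\<close>.\<close>
    define a where "a k = v n (s + real (if k < N then k else 0) * \<delta>)" for k
    have "a k \<in> K" for k using s(3,4)[of "if k < N then k else 0"] N0 by (auto simp: a_def)
    moreover have "step_fun \<delta> N a = step_fun \<delta> N (\<lambda>k. v n (s + real k * \<delta>))"
      by (auto simp: step_fun_def a_def fun_eq_iff)
    ultimately show ?thesis using s(5) unfolding T_eq by (intro exI[of _ a]) simp
  qed
  then obtain a where "\<forall>n. (\<forall>k. a n k \<in> K) \<and>
    power_integral q {0<..<T} (\<lambda>t. v n t - step_fun \<delta> N (a n) t) \<le> ennreal (4 * \<eta>)"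
    by metis
  then show ?thesis using \<delta>(1) T_eq K(1)
    by (intro exI[of _ \<delta>] exI[of _ N] exI[of _ K] exI[of _ a]) simp
qed

text \<open>Neither the distance from \<open>v (\<phi> n)\<close> to its level-m step function nor
  that from the limiting step function to \<open>w\<close> depends on how far the coefficients have
  converged; only the middle distance does, and it vanishes for fixed \<open>m\<close>.\<close>

lemma power_integral_subsequence:
  fixes v :: "nat \<Rightarrow> real \<Rightarrow> 'b::banach" and u :: "nat \<Rightarrow> real \<Rightarrow> ennreal"
  assumes T: "0 < T" and q: "1 \<le> q"
    and v: "\<And>n. strong_borel (v n)" and u: "\<And>n. u n \<in> borel_measurable borel"
    and le_u: "\<And>n. (\<integral>\<^sup>+t. indicator {0<..<T} t * u n t \<partial>lborel) \<le> ennreal C"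
    and cpt: "\<And>R. \<exists>K. compact K \<and>
      (\<forall>n. AE t in lborel. t \<in> {0<..<T} \<longrightarrow> u n t \<le> ennreal R \<longrightarrow> v n t \<in> K)"
    and transl: "\<And>\<eta>. 0 < \<eta> \<Longrightarrow> \<exists>d>0. \<forall>h. 0 < h \<and> h < d \<longrightarrow>
      (\<forall>n. power_integral q {0<..<T - h} (\<lambda>t. v n (t + h) - v n t) \<le> ennreal \<eta>)"
  obtains \<phi> w where "strict_mono \<phi>" "strong_borel w"
    "(\<lambda>n. power_integral q {0<..<T} (\<lambda>t. v (\<phi> n) t - w t)) \<longlonglongrightarrow> 0"
proof -
  define Q :: real where "Q = 2 powr q"
  have Q: "0 < Q" by (simp add: Q_def)
  \<comment> \<open>The q-th power of \<open>(1/4) ^ m\<close>, matching the rate demanded by the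
    completeness argument.\<close>
  define \<kappa> where "\<kappa> m = ((1/4) ^ m) powr q" for m :: nat
  have \<kappa>_pos: "0 < \<kappa> m" for m by (simp add: \<kappa>_def)
  define approx where "approx m \<delta> N K a \<longleftrightarrow>
    0 < \<delta> \<and> real N * \<delta> = T \<and> compact K \<and> (\<forall>n k. a n k \<in> K) \<and>
    (\<forall>n. power_integral q {0<..<T} (\<lambda>t. v n t - step_fun \<delta> N (a n) t) \<le> ennreal (\<kappa> m / Q))"
    for m \<delta> N K a
  have "\<exists>\<delta> N K a. approx m \<delta> N K a" for m
  proof -
    \<comment> \<open>The 4 cancels the factor lost in sampling, and \<open>Q\<close> the factor of
      the triangle inequality when two levels are compared.\<close>
    have pos: "0 < \<kappa> m / Q / 4" using \<kappa>_pos Q by simp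
    show ?thesis
      using uniform_step_approximation[OF T v u le_u cpt transl[OF pos] pos]
      unfolding approx_def by simp
  qed
  then obtain \<delta> N K a where "\<And>m. approx m (\<delta> m) (N m) (K m) (a m)" by metis
  then have \<delta>: "\<And>m. 0 < \<delta> m" and T_eq: "\<And>m. real (N m) * \<delta> m = T"
    and K: "\<And>m. compact (K m)" "\<And>m n k. a m n k \<in> K m"
    and near: "\<And>m n. power_integral q {0<..<T} (\<lambda>t. v n t - step_fun (\<delta> m) (N m) (a m n) t) \<le> ennreal (\<kappa> m / Q)"
    by (simp_all add: approx_def)
  obtain \<phi> l where \<phi>: "strict_mono \<phi>" and l: "\<And>m k. (\<lambda>n. a m (\<phi> n) k) \<longlonglongrightarrow> l m k"
    using compact_double_subsequence[of K "\<lambda>n m k. a m n k", OF K] by blast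
  define st where "st m n = step_fun (\<delta> m) (N m) (a m (\<phi> n))" for m n
  define \<sigma> where "\<sigma> m = step_fun (\<delta> m) (N m) (l m)" for m
  have simple: "simple_function borel (\<sigma> m)" "simple_function borel (st m n)" for m n
    unfolding \<sigma>_def st_def by (rule simple_function_step_fun[OF \<delta>])+
  note sb [simp] = simple[THEN simple_imp_strong_borel]
  have I [measurable]: "{0<..<T} \<in> sets borel" by simp
  have near_st: "power_integral q {0<..<T} (\<lambda>t. v (\<phi> n) t - st m n t) \<le> ennreal (\<kappa> m / Q)" for m n
    unfolding st_def by (rule near)
  \<comment> \<open>For each \<open>n\<close> the step functions of levels \<open>m\<close> and
    \<open>k\<close> are compared through the common function \<open>v (\<phi> n)\<close>; the bound
    survives \<open>n\<close> tending to infinity by Fatou's lemma.\<close>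
  have \<sigma>_Cauchy: "power_integral q {0<..<T} (\<lambda>t. \<sigma> m t - \<sigma> k t) \<le> ennreal (\<kappa> m + \<kappa> k)" for m k
  proof (rule power_integral_le_of_limit[of "\<lambda>n. st m n" "\<lambda>n. st k n"])
    have "power_integral q {0<..<T} (\<lambda>t. st m n t - st k n t) \<le> ennreal (\<kappa> m + \<kappa> k)" for n
    proof -
      have "power_integral q {0<..<T} (\<lambda>t. st m n t - st k n t)
        \<le> ennreal Q * (power_integral q {0<..<T} (\<lambda>t. st m n t - v (\<phi> n) t)
            + power_integral q {0<..<T} (\<lambda>t. v (\<phi> n) t - st k n t))"
        unfolding Q_def using v q by (intro power_integral_triangle) auto
      also have "\<dots> \<le> ennreal Q * (ennreal (\<kappa> m / Q) + ennreal (\<kappa> k / Q))"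
        using near_st power_integral_minus_commute[of q "{0<..<T}" "st m n" "v (\<phi> n)"]
        by (intro mult_left_mono add_mono) auto
      also have "\<dots> = ennreal (\<kappa> m + \<kappa> k)"
        using Q \<kappa>_pos[of m] \<kappa>_pos[of k]
        by (simp add: ennreal_plus[symmetric] ennreal_mult[symmetric] field_simps del: ennreal_plus)
      finally show ?thesis .
    qed
    then show "\<forall>\<^sub>F n in sequentially. power_integral q {0<..<T} (\<lambda>t. st m n t - st k n t) \<le> ennreal (\<kappa> m + \<kappa> k)"
      by simp
    have "(\<lambda>n. st m n t - st k n t) \<longlonglongrightarrow> \<sigma> m t - \<sigma> k t" for t
      unfolding st_def \<sigma>_def by (intro tendsto_diff step_fun_tendsto l)
    then show "AE t in lborel. t \<in> {0<..<T} \<longrightarrow> (\<lambda>n. st m n t - st k n t) \<longlonglongrightarrow> \<sigma> m t - \<sigma> k t"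
      by simp
  qed (use q in auto)
  obtain w where w: "strong_borel w"
    and near_w: "\<And>m. power_integral q {0<..<T} (\<lambda>t. \<sigma> m t - w t) \<le> ennreal (2 * \<kappa> m)"
    using power_integral_complete[of \<sigma>, OF simple(1) I q \<sigma>_Cauchy[unfolded \<kappa>_def]]
    unfolding \<kappa>_def by blast
  define \<rho> where "\<rho> m n = T * (\<Sum>k<N m. norm (a m (\<phi> n) k - l m k)) powr q" for m n
  \<comment> \<open>The route is from \<open>v (\<phi> n)\<close> over \<open>st m n\<close> and
    \<open>\<sigma> m\<close> to \<open>w\<close>; the two nested triangle inequalities produce the
    nested factors \<open>Q\<close>.\<close>
  have bound: "power_integral q {0<..<T} (\<lambda>t. v (\<phi> n) t - w t)
    \<le> ennreal (Q * (\<kappa> m / Q + Q * (\<rho> m n + 2 * \<kappa> m)))" for m n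
  proof -
    have "power_integral q {0<..<T} (\<lambda>t. st m n t - \<sigma> m t) \<le> ennreal (\<rho> m n)"
      using power_integral_step_fun_diff_le[OF \<delta>[of m], of q "N m" "a m (\<phi> n)" "l m"] q
      unfolding T_eq st_def \<sigma>_def \<rho>_def by simp
    then have "ennreal Q * (power_integral q {0<..<T} (\<lambda>t. st m n t - \<sigma> m t)
        + power_integral q {0<..<T} (\<lambda>t. \<sigma> m t - w t)) \<le> ennreal Q * (ennreal (\<rho> m n) + ennreal (2 * \<kappa> m))"
      using near_w[of m] by (intro mult_left_mono add_mono) auto
    moreover have "power_integral q {0<..<T} (\<lambda>t. st m n t - w t)
      \<le> ennreal Q * (power_integral q {0<..<T} (\<lambda>t. st m n t - \<sigma> m t)
          + power_integral q {0<..<T} (\<lambda>t. \<sigma> m t - w t))"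
      unfolding Q_def using v w q by (intro power_integral_triangle) auto
    ultimately have "power_integral q {0<..<T} (\<lambda>t. st m n t - w t)
      \<le> ennreal Q * (ennreal (\<rho> m n) + ennreal (2 * \<kappa> m))" by (rule order_trans[rotated])
    then have "ennreal Q * (power_integral q {0<..<T} (\<lambda>t. v (\<phi> n) t - st m n t)
          + power_integral q {0<..<T} (\<lambda>t. st m n t - w t))
      \<le> ennreal Q * (ennreal (\<kappa> m / Q) + ennreal Q * (ennreal (\<rho> m n) + ennreal (2 * \<kappa> m)))"
      using near_st[of n m] by (intro mult_left_mono add_mono) auto
    moreover have "power_integral q {0<..<T} (\<lambda>t. v (\<phi> n) t - w t)
      \<le> ennreal Q * (power_integral q {0<..<T} (\<lambda>t. v (\<phi> n) t - st m n t)
          + power_integral q {0<..<T} (\<lambda>t. st m n t - w t))"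
      unfolding Q_def using v w q by (intro power_integral_triangle) auto
    moreover have "ennreal Q * (ennreal (\<kappa> m / Q) + ennreal Q * (ennreal (\<rho> m n) + ennreal (2 * \<kappa> m)))
      = ennreal (Q * (\<kappa> m / Q + Q * (\<rho> m n + 2 * \<kappa> m)))"
    proof -
      have "0 \<le> \<rho> m n" using T by (simp add: \<rho>_def)
      then show ?thesis using Q \<kappa>_pos[of m] by (simp add: ennreal_plus ennreal_mult)
    qed
    ultimately show ?thesis by simp
  qed
  have "(\<lambda>n. power_integral q {0<..<T} (\<lambda>t. v (\<phi> n) t - w t)) \<longlonglongrightarrow> 0"
  proof (rule tendsto_zero_ennreal)
    fix \<epsilon> :: real assume "0 < \<epsilon>"
    \<comment> \<open>The level \<open>m\<close> is fixed before \<open>n\<close>: with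
      \<open>\<rho>\<close> replaced by its limit 0 the bound is below \<open>\<epsilon>\<close> for
      large \<open>m\<close>, and for such an \<open>m\<close> the full bound is below
      \<open>\<epsilon>\<close> for all large \<open>n\<close>.\<close>
    have "\<kappa> \<longlonglongrightarrow> 0 powr q"
      unfolding \<kappa>_def using q by (intro tendsto_powr' LIMSEQ_power_zero tendsto_const) auto
    then have "(\<lambda>m. Q * (\<kappa> m / Q + Q * (0 + 2 * \<kappa> m))) \<longlonglongrightarrow> Q * (0 / Q + Q * (0 + 2 * 0))"
      using q Q by (intro tendsto_intros) auto
    then have "\<forall>\<^sub>F m in sequentially. Q * (\<kappa> m / Q + Q * (0 + 2 * \<kappa> m)) < \<epsilon>"
      using \<open>0 < \<epsilon>\<close> by (intro order_tendstoD) auto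
    then obtain m where m: "Q * (\<kappa> m / Q + Q * (0 + 2 * \<kappa> m)) < \<epsilon>"
      by (auto simp: eventually_sequentially)
    have "(\<lambda>n. \<rho> m n) \<longlonglongrightarrow> T * (\<Sum>k<N m. norm (l m k - l m k)) powr q"
      unfolding \<rho>_def using q by (intro tendsto_intros tendsto_powr' l) (auto simp: sum_nonneg)
    then have "(\<lambda>n. \<rho> m n) \<longlonglongrightarrow> 0" using q by simp
    then have "(\<lambda>n. Q * (\<kappa> m / Q + Q * (\<rho> m n + 2 * \<kappa> m))) \<longlonglongrightarrow> Q * (\<kappa> m / Q + Q * (0 + 2 * \<kappa> m))"
      by (intro tendsto_intros)
    with m have "\<forall>\<^sub>F n in sequentially. Q * (\<kappa> m / Q + Q * (\<rho> m n + 2 * \<kappa> m)) < \<epsilon>"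
      by (intro order_tendstoD)
    then show "\<forall>\<^sub>F n in sequentially. power_integral q {0<..<T} (\<lambda>t. v (\<phi> n) t - w t) < ennreal \<epsilon>"
      by eventually_elim (use bound[of _ m] \<open>0 < \<epsilon>\<close> in \<open>meson ennreal_lessI order_le_less_trans\<close>)
  qed
  with \<phi> w show thesis by (rule that)
qed

subsection \<open>Passage to the spaces \<open>L\<^sup>p\<close>\<close>

lemma power_integral_cong_AE:
  assumes "AE t in lborel. t \<in> S \<longrightarrow> f t = g t"
  shows "power_integral q S f = power_integral q S g"
  unfolding power_integral_def using assms
  by (intro nn_integral_cong_AE, elim eventually_mono) (auto simp: indicator_def)

lemma Lpnorm_finite:
  assumes "p \<noteq> top"
  shows "Lpnorm S p f = (if power_integral (enn2real p) S f = top then top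
    else ennreal (enn2real (power_integral (enn2real p) S f) powr (1 / enn2real p)))"
  using assms by (simp add: Lpnorm_def power_integral_def nn_integral_completion Let_def)

lemma power_integral_le_of_Lpnorm:
  assumes "p \<noteq> top" "0 < enn2real p" "Lpnorm S p f \<le> ennreal \<epsilon>" "0 \<le> \<epsilon>"
  shows "power_integral (enn2real p) S f \<le> ennreal (\<epsilon> powr enn2real p)"
proof -
  define I where "I = power_integral (enn2real p) S f"
  have I: "I \<noteq> top" "ennreal (enn2real I powr (1 / enn2real p)) \<le> ennreal \<epsilon>"
    using assms(3) unfolding Lpnorm_finite[OF assms(1)] I_def[symmetric]
    by (auto split: if_splits simp: top_unique)
  then have "enn2real I powr (1 / enn2real p) \<le> \<epsilon>" using assms(4) by (simp add: ennreal_le_iff)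
  then have "(enn2real I powr (1 / enn2real p)) powr enn2real p \<le> \<epsilon> powr enn2real p"
    using assms(2) by (intro powr_mono2) auto
  then have "enn2real I \<le> \<epsilon> powr enn2real p" using assms(2) by (simp add: powr_powr)
  then show ?thesis using I(1) unfolding I_def[symmetric]
    by (metis ennreal_enn2real ennreal_leI less_top)
qed

lemma Lpnorm_less_of_power_integral:
  assumes "p \<noteq> top" "0 < enn2real p" "power_integral (enn2real p) S f < ennreal (\<epsilon> powr enn2real p)" "0 < \<epsilon>"
  shows "Lpnorm S p f < ennreal \<epsilon>"
proof -
  define I where "I = power_integral (enn2real p) S f"
  have I: "I < ennreal (\<epsilon> powr enn2real p)" using assms(3) by (simp add: I_def)
  then have "I \<noteq> top" by auto
  then obtain i where i: "I = ennreal i" "0 \<le> i" by (cases I) auto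
  then have "i < \<epsilon> powr enn2real p" using I by (simp add: ennreal_less_iff)
  then have "i powr (1 / enn2real p) < (\<epsilon> powr enn2real p) powr (1 / enn2real p)"
    using i assms(2) by (intro powr_less_mono2) auto
  then have "i powr (1 / enn2real p) < \<epsilon>" using assms(2,4) by (simp add: powr_powr)
  then show ?thesis
    unfolding Lpnorm_finite[OF assms(1)] I_def[symmetric] using i assms(4) by (simp add: ennreal_less_iff)
qed

lemma AE_of_Lpnorm_top_less:
  assumes "Lpnorm S top f < C"
  shows "AE t in lborel. t \<in> S \<longrightarrow> ennreal (norm (f t)) \<le> C"
proof -
  obtain c where c: "AE t in lborel. t \<in> S \<longrightarrow> ennreal (norm (f t)) \<le> c" "c < C"
    using assms unfolding Lpnorm_def AE_completion_iff by (auto simp: Inf_less_iff)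
  from c(1) show ?thesis by eventually_elim (use c(2) in auto)
qed

lemma Lpnorm_top_le:
  assumes "AE t in lborel. t \<in> S \<longrightarrow> ennreal (norm (f t)) \<le> C"
  shows "Lpnorm S top f \<le> C"
  using assms by (auto simp: Lpnorm_def AE_completion_iff intro: Inf_lower)

lemma AE_eq_translate_diff:
  fixes f g :: "real \<Rightarrow> 'a::real_normed_vector"
  assumes eq: "AE t in lborel. t \<in> {0<..<T} \<longrightarrow> f t = g t" and "0 < h"
  shows "AE t in lborel. t \<in> {0<..<T - h} \<longrightarrow> f (t + h) - f t = g (t + h) - g t"
  using eq AE_lborel_shift[OF eq, of h] by eventually_elim (use \<open>0 < h\<close> in auto)

lemma Lp_space_ex_strong_borel:
  assumes "f \<in> Lp_space S p" "S \<in> sets borel"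
  shows "\<exists>f'. strong_borel f' \<and> (AE t in lborel. t \<in> S \<longrightarrow> f t = f' t)"
proof -
  have "strongly_measurable_on S f" "S \<in> sets lebesgue"
    using assms by (auto simp: Lp_space_def)
  from strongly_measurable_on_imp_strong_borel[OF this] show ?thesis by blast
qed

text \<open>The only use of compactness of \<open>B\<close>. Where the size \<open>\<rho>\<close> of
  \<open>u\<close> is at most \<open>R\<close>, the value of \<open>x\<close> lies in the closure of
  the image of one ball, which is compact and independent of \<open>n\<close>. Allowing
  \<open>x\<close> to be any version of the image makes this available for Borel versions and for
  continuous representatives alike.\<close>

lemma compact_operator_bounded_data:
  fixes B :: "'a::real_normed_vector \<Rightarrow> 'b::real_normed_vector"
  assumes B: "compact_operator B" and S: "S \<in> sets borel"
    and u: "\<And>n::nat. u n \<in> Lp_space S 1" "\<And>n. Lpnorm S 1 (u n) \<le> ennreal C"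
    and x: "\<And>n. AE t in lborel. t \<in> S \<longrightarrow> x n t = B (u n t)"
  obtains \<rho> where "\<And>n. \<rho> n \<in> borel_measurable borel"
    "\<And>n. (\<integral>\<^sup>+t. indicator S t * \<rho> n t \<partial>lborel) \<le> ennreal (max C 0)"
    "\<And>R. \<exists>K. compact K \<and> (\<forall>n. AE t in lborel. t \<in> S \<longrightarrow> \<rho> n t \<le> ennreal R \<longrightarrow> x n t \<in> K)"
proof -
  obtain u' where u': "\<And>n. strong_borel (u' n)" "\<And>n. AE t in lborel. t \<in> S \<longrightarrow> u n t = u' n t"
    using Lp_space_ex_strong_borel[OF u(1) S] by metis
  define \<rho> where "\<rho> n t = ennreal (norm (u' n t))" for n t
  show thesis
  proof
    fix n
    have "(\<lambda>t. norm (u' n t)) \<in> borel_measurable borel"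
      using u'(1) by (rule strong_borel_norm) simp
    then show "\<rho> n \<in> borel_measurable borel" unfolding \<rho>_def by simp
    have "(\<integral>\<^sup>+t. indicator S t * \<rho> n t \<partial>lborel) = power_integral 1 S (u' n)"
      by (simp add: \<rho>_def power_integral_def)
    also have "\<dots> = power_integral 1 S (u n)"
      using power_integral_cong_AE[OF u'(2)] by simp
    also have "\<dots> \<le> ennreal (max C 0 powr enn2real 1)"
      using power_integral_le_of_Lpnorm[of 1 S "u n" "max C 0"] order_trans[OF u(2) ennreal_leI[of C "max C 0"]]
      by simp
    finally show "(\<integral>\<^sup>+t. indicator S t * \<rho> n t \<partial>lborel) \<le> ennreal (max C 0)" by simp
  next
    fix R :: real
    \<comment> \<open>\<open>ennreal\<close> sends negative reals to 0, hence the radius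
      \<open>max R 0\<close>.\<close>
    have "compact (closure (B ` cball 0 (max R 0)))"
      using B unfolding compact_operator_def by blast
    moreover have "AE t in lborel. t \<in> S \<longrightarrow> \<rho> n t \<le> ennreal R \<longrightarrow> x n t \<in> closure (B ` cball 0 (max R 0))" for n
      using u'(2)[of n] x[of n]
    proof eventually_elim
      case (elim t)
      show ?case
      proof (intro impI)
        assume t: "t \<in> S" "\<rho> n t \<le> ennreal R"
        then have "ennreal (norm (u n t)) \<le> ennreal R" using elim by (simp add: \<rho>_def)
        also have "\<dots> \<le> ennreal (max R 0)" by (rule ennreal_leI) simp
        finally have "norm (u n t) \<le> max R 0" by (simp only: ennreal_le_iff max.cobounded2)
        then have "u n t \<in> cball 0 (max R 0)" by simp
        then have "B (u n t) \<in> closure (B ` cball 0 (max R 0))"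
          by (intro subsetD[OF closure_subset] imageI)
        then show "x n t \<in> closure (B ` cball 0 (max R 0))" using elim t(1) by simp
      qed
    qed
    ultimately show "\<exists>K. compact K \<and> (\<forall>n. AE t in lborel. t \<in> S \<longrightarrow> \<rho> n t \<le> ennreal R \<longrightarrow> x n t \<in> K)"
      by blast
  qed
qed

text \<open>Step functions with the values of \<open>g\<close> at left end points of cells converge
  pointwise, since these end points tend to \<open>t\<close>; boundedness comes from compactness of
  the closed interval.\<close>

lemma continuous_on_imp_Lp_space_top:
  fixes g :: "real \<Rightarrow> 'b::real_normed_vector"
  assumes g: "continuous_on {0..T} g" and T: "0 < T"
  shows "g \<in> Lp_space {0<..<T} top"
proof -
  define \<delta> where "\<delta> m = T / real (Suc m)" for m
  have \<delta>: "0 < \<delta> m" "real (Suc m) * \<delta> m = T" for m using T by (simp_all add: \<delta>_def)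
  have "strongly_measurable_on {0<..<T} g"
  proof (rule simple_limit_strongly_measurable_on)
    show "simple_function borel (step_fun (\<delta> m) (Suc m) (\<lambda>k. g (real k * \<delta> m)))" for m
      by (rule simple_function_step_fun[OF \<delta>(1)])
    have "(\<lambda>m. step_fun (\<delta> m) (Suc m) (\<lambda>k. g (real k * \<delta> m)) t) \<longlonglongrightarrow> g t" if t: "t \<in> {0<..<T}" for t
    proof -
      define c where "c m = real (cell (\<delta> m) (Suc m) t) * \<delta> m" for m
      have cell: "cell (\<delta> m) (Suc m) t < Suc m" "c m \<le> t" "t < c m + \<delta> m" for m
        unfolding c_def using t by (intro cell_bounds[OF \<delta>(1)]; simp add: \<delta>(2) del: of_nat_Suc)+
      have "\<delta> \<longlonglongrightarrow> 0" unfolding \<delta>_def by (rule LIMSEQ_Suc[OF lim_const_over_n])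
      then have "(\<lambda>m. t - \<delta> m) \<longlonglongrightarrow> t - 0" by (intro tendsto_intros)
      then have "c \<longlonglongrightarrow> t"
        by (intro tendsto_sandwich[of "\<lambda>m. t - \<delta> m" c _ "\<lambda>_. t"])
          (use cell in \<open>auto intro!: always_eventually less_imp_le simp: less_diff_eq diff_less_eq\<close>)
      moreover have "0 \<le> c m" for m using \<delta>(1)[of m] by (simp add: c_def)
      ultimately have "(\<lambda>m. g (c m)) \<longlonglongrightarrow> g t"
        using t order_trans[OF cell(2), of T]
        by (intro continuous_on_tendsto_compose[OF g]) (auto intro!: always_eventually)
      then show ?thesis using cell(1) by (simp add: step_fun_def c_def)
    qed
    then show "AE t in lborel. t \<in> {0<..<T} \<longrightarrow>
      (\<lambda>m. step_fun (\<delta> m) (Suc m) (\<lambda>k. g (real k * \<delta> m)) t) \<longlonglongrightarrow> g t" by simp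
  qed simp
  moreover have "bounded (g ` {0..T})"
    by (intro compact_imp_bounded compact_continuous_image g compact_Icc)
  then obtain M where "\<And>t. t \<in> {0..T} \<Longrightarrow> norm (g t) \<le> M" unfolding bounded_iff by blast
  then have "Lpnorm {0<..<T} top g \<le> ennreal M"
    by (intro Lpnorm_top_le) (auto intro!: ennreal_leI)
  ultimately show ?thesis by (auto simp: Lp_space_def intro: order_le_less_trans)
qed

theorem theorem1:
  fixes B :: "'a::banach \<Rightarrow> 'b::banach"
    and T :: real and p :: ennreal
    and U :: "(real \<Rightarrow> 'a) set" and V :: "(real \<Rightarrow> 'b) set"
  assumes T: "T > 0"
    and p: "1 \<le> p"
    and B: "compact_operator B"
    and U_L1: "U \<subseteq> Lp_space {0<..<T} 1"
    and U_bdd: "\<exists>C::real. \<forall>u\<in>U. Lpnorm {0<..<T} 1 u \<le> ennreal C"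
    and V_def: "V = {B \<circ> u | u. u \<in> U}"
    and V_Lp: "V \<subseteq> Lp_space {0<..<T} p"
    and V_Lr: "\<exists>r::ennreal. r > 1 \<and> (\<exists>C::real. \<forall>v\<in>V. Lpnorm {0<..<T} r v \<le> ennreal C)"
    and transl: "\<forall>\<epsilon>>0. \<exists>\<delta>>0. \<forall>h. 0 < h \<and> h < \<delta> \<longrightarrow>
                   (\<forall>v\<in>V. Lpnorm {0<..<T-h} p (\<lambda>t. v (t + h) - v t) < ennreal \<epsilon>)"
  shows "(\<forall>v :: nat \<Rightarrow> real \<Rightarrow> 'b. (\<forall>n. v n \<in> V) \<longrightarrow>
            (\<exists>\<phi> w. strict_mono \<phi> \<and> w \<in> Lp_space {0<..<T} p \<and>
                   (\<lambda>n. Lpnorm {0<..<T} p (\<lambda>t. v (\<phi> n) t - w t)) \<longlonglongrightarrow> 0))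
       \<and> (p = top \<longrightarrow>
            (\<forall>v\<in>V. \<exists>w. continuous_on {0..T} w \<and> (AE t in lebesgue. t \<in> {0<..<T} \<longrightarrow> v t = w t)) \<and>
            (\<forall>w :: nat \<Rightarrow> real \<Rightarrow> 'b.
               (\<forall>n. continuous_on {0..T} (w n) \<and>
                    (\<exists>v\<in>V. AE t in lebesgue. t \<in> {0<..<T} \<longrightarrow> v t = w n t)) \<longrightarrow>
               (\<exists>\<phi> g. strict_mono \<phi> \<and> continuous_on {0..T} g \<and>
                      uniform_limit {0..T} (\<lambda>n. w (\<phi> n)) g sequentially)))"
proof -
  obtain C where C: "\<And>u. u \<in> U \<Longrightarrow> Lpnorm {0<..<T} 1 u \<le> ennreal C"
    using U_bdd by blast
  have data: "\<exists>\<rho>. (\<forall>n. \<rho> n \<in> borel_measurable borel) \<and>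
      (\<forall>n. (\<integral>\<^sup>+t. indicator {0<..<T} t * \<rho> n t \<partial>lborel) \<le> ennreal (max C 0)) \<and>
      (\<forall>R. \<exists>K. compact K \<and> (\<forall>n. AE t in lborel. t \<in> {0<..<T} \<longrightarrow> \<rho> n t \<le> ennreal R \<longrightarrow> x n t \<in> K))"
    if v: "\<And>n. v n \<in> V" and x: "\<And>n. AE t in lborel. t \<in> {0<..<T} \<longrightarrow> v n t = x n t"
    for v x :: "nat \<Rightarrow> real \<Rightarrow> 'b"
  proof -
    have "\<forall>n. \<exists>u\<in>U. v n = B \<circ> u" using v V_def by blast
    then obtain u where u: "\<And>n. u n \<in> U" "\<And>n. v n = B \<circ> u n" by metis
    show ?thesis
    proof (rule compact_operator_bounded_data[OF B, of "{0<..<T}" u C x])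
      show "u n \<in> Lp_space {0<..<T} 1" "Lpnorm {0<..<T} 1 (u n) \<le> ennreal C" for n
        using u(1) U_L1 C by auto
      show "AE t in lborel. t \<in> {0<..<T} \<longrightarrow> x n t = B (u n t)" for n
        using x[of n] by eventually_elim (simp add: u(2))
    qed (simp, blast)
  qed
  have transl_ex: "\<exists>d>0. \<forall>h. 0 < h \<and> h < d \<longrightarrow>
      (\<forall>v\<in>V. Lpnorm {0<..<T - h} p (\<lambda>t. v (t + h) - v t) < ennreal \<epsilon>)" if "0 < \<epsilon>" for \<epsilon>
    using transl that by blast
  show ?thesis
  proof (cases "p = top")
    case False
    define q where "q = enn2real p"
    have q: "1 \<le> q"
      using p False unfolding q_def by (cases p) auto
    have "\<exists>\<phi> w. strict_mono \<phi> \<and> w \<in> Lp_space {0<..<T} p \<and>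
        (\<lambda>n. Lpnorm {0<..<T} p (\<lambda>t. v (\<phi> n) t - w t)) \<longlonglongrightarrow> 0"
      if v: "\<And>n. v n \<in> V" for v :: "nat \<Rightarrow> real \<Rightarrow> 'b"
    proof -
      have "\<exists>v'. strong_borel v' \<and> (AE t in lborel. t \<in> {0<..<T} \<longrightarrow> v n t = v' t)" for n
        using v V_Lp by (intro Lp_space_ex_strong_borel[of _ _ p]) auto
      then obtain v' where v': "\<And>n. strong_borel (v' n)"
        "\<And>n. AE t in lborel. t \<in> {0<..<T} \<longrightarrow> v n t = v' n t" by metis
      from data[of v v', OF v v'(2)] obtain \<rho> where "\<forall>n. \<rho> n \<in> borel_measurable borel"
        "\<forall>n. (\<integral>\<^sup>+t. indicator {0<..<T} t * \<rho> n t \<partial>lborel) \<le> ennreal (max C 0)"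
        "\<forall>R. \<exists>K. compact K \<and> (\<forall>n. AE t in lborel. t \<in> {0<..<T} \<longrightarrow> \<rho> n t \<le> ennreal R \<longrightarrow> v' n t \<in> K)"
        by (elim exE conjE)
      note \<rho> = this[THEN spec]
      have "\<exists>d>0. \<forall>h. 0 < h \<and> h < d \<longrightarrow>
        (\<forall>n. power_integral q {0<..<T - h} (\<lambda>t. v' n (t + h) - v' n t) \<le> ennreal \<eta>)"
        if "0 < \<eta>" for \<eta>
      proof -
        \<comment> \<open>A bound \<open>\<eta> powr (1 / q)\<close> on the norm is a bound
          \<open>\<eta>\<close> on the power integral.\<close>
        have "0 < \<eta> powr (1 / q)" using that by simp
        from transl_ex[OF this] obtain d where d: "0 < d" "\<And>h v. 0 < h \<Longrightarrow> h < d \<Longrightarrow> v \<in> V \<Longrightarrow>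
          Lpnorm {0<..<T - h} p (\<lambda>t. v (t + h) - v t) < ennreal (\<eta> powr (1 / q))"
          by blast
        have "power_integral q {0<..<T - h} (\<lambda>t. v' n (t + h) - v' n t) \<le> ennreal \<eta>"
          if h: "0 < h" "h < d" for h n
        proof -
          have "power_integral q {0<..<T - h} (\<lambda>t. v' n (t + h) - v' n t)
            = power_integral q {0<..<T - h} (\<lambda>t. v n (t + h) - v n t)"
            by (rule power_integral_cong_AE[OF AE_eq_translate_diff[OF v'(2) h(1)], symmetric])
          also have "\<dots> \<le> ennreal ((\<eta> powr (1 / q)) powr q)"
            unfolding q_def using q less_imp_le[OF d(2)[OF h v[of n]]]
            by (intro power_integral_le_of_Lpnorm False) (auto simp: q_def)
          also have "(\<eta> powr (1 / q)) powr q = \<eta>" using q \<open>0 < \<eta>\<close> by (simp add: powr_powr)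
          finally show ?thesis .
        qed
        with d(1) show ?thesis by blast
      qed
      from power_integral_subsequence[where v = v' and u = \<rho>, OF T q v'(1) \<rho> this] obtain \<phi> w where
        \<phi>: "strict_mono \<phi>" and w: "strong_borel w"
        and lim: "(\<lambda>n. power_integral q {0<..<T} (\<lambda>t. v' (\<phi> n) t - w t)) \<longlonglongrightarrow> 0" by blast
      have eq: "power_integral q {0<..<T} (\<lambda>t. v (\<phi> n) t - w t)
        = power_integral q {0<..<T} (\<lambda>t. v' (\<phi> n) t - w t)" for n
      proof (rule power_integral_cong_AE)
        show "AE t in lborel. t \<in> {0<..<T} \<longrightarrow> v (\<phi> n) t - w t = v' (\<phi> n) t - w t"
          using v'(2)[of "\<phi> n"] by eventually_elim simp
      qed
      have "(\<lambda>n. Lpnorm {0<..<T} p (\<lambda>t. v (\<phi> n) t - w t)) \<longlonglongrightarrow> 0"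
      proof (rule tendsto_zero_ennreal)
        fix \<epsilon> :: real assume "0 < \<epsilon>"
        then have "\<forall>\<^sub>F n in sequentially. power_integral q {0<..<T} (\<lambda>t. v' (\<phi> n) t - w t) < ennreal (\<epsilon> powr q)"
          using lim by (intro order_tendstoD) (auto simp: ennreal_less_zero_iff)
        then show "\<forall>\<^sub>F n in sequentially. Lpnorm {0<..<T} p (\<lambda>t. v (\<phi> n) t - w t) < ennreal \<epsilon>"
        proof eventually_elim
          case (elim n)
          then show ?case
            using q \<open>0 < \<epsilon>\<close> eq[of n] unfolding q_def
            by (intro Lpnorm_less_of_power_integral False) auto
        qed
      qed
      moreover have "w \<in> Lp_space {0<..<T} p"
      proof -
        have "\<forall>\<^sub>F n in sequentially. power_integral q {0<..<T} (\<lambda>t. v' (\<phi> n) t - w t) < 1"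
          using lim by (rule order_tendstoD) simp
        then obtain n where n: "power_integral q {0<..<T} (\<lambda>t. v' (\<phi> n) t - w t) < 1"
          by (auto simp: eventually_sequentially)
        have "Lpnorm {0<..<T} p (v (\<phi> n)) < top" using v V_Lp by (auto simp: Lp_space_def)
        then have "power_integral q {0<..<T} (v (\<phi> n)) < top"
          unfolding Lpnorm_finite[OF False] q_def by (auto split: if_splits simp: less_top)
        then have "power_integral q {0<..<T} (v' (\<phi> n)) < top"
          using power_integral_cong_AE[OF v'(2)] by simp
        \<comment> \<open>Membership of the limit follows from one term of the sequence:
          \<open>w\<close> is compared with 0 through \<open>v' (\<phi> n)\<close>.\<close>
        have "power_integral q {0<..<T} (\<lambda>t. w t - 0) \<le> ennreal (2 powr q) *
          (power_integral q {0<..<T} (\<lambda>t. w t - v' (\<phi> n) t) + power_integral q {0<..<T} (\<lambda>t. v' (\<phi> n) t - 0))"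
          using q w v'(1) by (intro power_integral_triangle) (auto intro!: simple_imp_strong_borel)
        also have "\<dots> < top"
          using n \<open>power_integral q {0<..<T} (v' (\<phi> n)) < top\<close>
          by (auto simp: power_integral_minus_commute[of q _ w] ennreal_mult_less_top intro: order_less_trans)
        finally have "Lpnorm {0<..<T} p w < top"
          unfolding Lpnorm_finite[OF False] q_def by (auto split: if_splits)
        moreover have "strongly_measurable_on {0<..<T} w"
          using w by (rule strong_borel_imp_strongly_measurable_on) simp
        ultimately show ?thesis by (simp add: Lp_space_def)
      qed
      ultimately show ?thesis using \<phi> by blast
    qed
    with False show ?thesis by blast
  next
    case True
    have shift_AE: "\<exists>d>0. \<forall>h. 0 < h \<and> h < d \<longrightarrow>
        (\<forall>v\<in>V. AE t in lborel. t \<in> {0<..<T - h} \<longrightarrow> norm (v (t + h) - v t) \<le> \<epsilon>)" if "0 < \<epsilon>" for \<epsilon>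
    proof -
      have "AE t in lborel. t \<in> {0<..<T - h} \<longrightarrow> norm (v (t + h) - v t) \<le> \<epsilon>"
        if "Lpnorm {0<..<T - h} p (\<lambda>t. v (t + h) - v t) < ennreal \<epsilon>" for h and v :: "real \<Rightarrow> 'b"
        using AE_of_Lpnorm_top_less[OF that[unfolded True]]
        by eventually_elim (use \<open>0 < \<epsilon>\<close> in \<open>simp add: ennreal_le_iff\<close>)
      then show ?thesis using transl_ex[OF that] by meson
    qed
    have representative: "\<exists>w. continuous_on {0..T} w \<and> (AE t in lborel. t \<in> {0<..<T} \<longrightarrow> v t = w t)"
      if v: "v \<in> V" for v
    proof -
      obtain v' where v': "strong_borel v'" "AE t in lborel. t \<in> {0<..<T} \<longrightarrow> v t = v' t"
        using Lp_space_ex_strong_borel[of v "{0<..<T}" p] v V_Lp by auto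
      have "\<exists>d>0. \<forall>h. 0 < h \<and> h < d \<longrightarrow>
        (AE t in lborel. t \<in> {0<..<T - h} \<longrightarrow> norm (v' (t + h) - v' t) \<le> \<epsilon>)" if "0 < \<epsilon>" for \<epsilon>
      proof -
        obtain d where d: "0 < d" "\<And>h. 0 < h \<Longrightarrow> h < d \<Longrightarrow>
          AE t in lborel. t \<in> {0<..<T - h} \<longrightarrow> norm (v (t + h) - v t) \<le> \<epsilon>"
          using shift_AE[OF \<open>0 < \<epsilon>\<close>] v by blast
        have "AE t in lborel. t \<in> {0<..<T - h} \<longrightarrow> norm (v' (t + h) - v' t) \<le> \<epsilon>"
          if "0 < h" "h < d" for h
          using d(2)[OF that] AE_eq_translate_diff[OF v'(2) that(1)] by eventually_elim auto
        with d(1) show ?thesis by blast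
      qed
      from continuous_representative[OF v'(1) T this] obtain w where
        w: "continuous_on {0..T} w" "AE t in lborel. t \<in> {0<..<T} \<longrightarrow> v' t = w t" by blast
      have "AE t in lborel. t \<in> {0<..<T} \<longrightarrow> v t = w t"
        using v'(2) w(2) by eventually_elim auto
      with w(1) show ?thesis by blast
    qed
    \<comment> \<open>Stated for arbitrary continuous representatives, this gives relative
      compactness among continuous functions and, after a choice of representatives, also
      convergence in the essential supremum norm.\<close>
    have subsequence: "\<exists>\<phi> g. strict_mono \<phi> \<and> continuous_on {0..T} g \<and>
        uniform_limit {0..T} (\<lambda>n. w (\<phi> n)) g sequentially"
      if cont: "\<And>n. continuous_on {0..T} (w n)"
        and w: "\<And>n. \<exists>v\<in>V. AE t in lborel. t \<in> {0<..<T} \<longrightarrow> v t = w n t"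
      for w :: "nat \<Rightarrow> real \<Rightarrow> 'b"
    proof -
      obtain v where v: "\<And>n. v n \<in> V" "\<And>n. AE t in lborel. t \<in> {0<..<T} \<longrightarrow> v n t = w n t"
        using w by metis
      from data[of v w, OF v] obtain \<rho> where "\<forall>n. \<rho> n \<in> borel_measurable borel"
        "\<forall>n. (\<integral>\<^sup>+t. indicator {0<..<T} t * \<rho> n t \<partial>lborel) \<le> ennreal (max C 0)"
        "\<forall>R. \<exists>K. compact K \<and> (\<forall>n. AE t in lborel. t \<in> {0<..<T} \<longrightarrow> \<rho> n t \<le> ennreal R \<longrightarrow> w n t \<in> K)"
        by (elim exE conjE)
      note \<rho> = this[THEN spec]
      have "\<exists>d>0. \<forall>n. \<forall>t\<in>{0..T}. \<forall>\<tau>\<in>{0..T}. \<bar>t - \<tau>\<bar> < d \<longrightarrow> norm (w n t - w n \<tau>) \<le> \<epsilon>"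
        if "0 < \<epsilon>" for \<epsilon>
      proof -
        obtain d where d: "0 < d" "\<And>h v. 0 < h \<Longrightarrow> h < d \<Longrightarrow> v \<in> V \<Longrightarrow>
          AE t in lborel. t \<in> {0<..<T - h} \<longrightarrow> norm (v (t + h) - v t) \<le> \<epsilon>"
          using shift_AE[OF \<open>0 < \<epsilon>\<close>] by blast
        have shift: "norm (w n (t + h) - w n t) \<le> \<epsilon>"
          if h: "0 < h" "h < d" "h < T" and t: "0 \<le> t" "t \<le> T - h" for n h t
        proof (rule continuous_AE_shift_bound[OF cont h(1,3) _ t])
          show "AE t in lborel. t \<in> {0<..<T - h} \<longrightarrow> norm (w n (t + h) - w n t) \<le> \<epsilon>"
            using d(2)[OF h(1,2) v(1)[of n]] AE_eq_translate_diff[OF v(2)[of n] h(1)]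
            by eventually_elim auto
        qed
        \<comment> \<open>The minimum with \<open>T\<close> keeps the shift shorter than the
          interval, as the pointwise bound for continuous functions assumes.\<close>
        have "norm (w n t - w n \<tau>) \<le> \<epsilon>"
          if "t \<in> {0..T}" "\<tau> \<in> {0..T}" "\<bar>t - \<tau>\<bar> < min d T" for n t \<tau>
        proof -
          consider "t < \<tau>" | "\<tau> < t" | "t = \<tau>" by linarith
          then show ?thesis
          proof cases
            case 1
            then show ?thesis using shift[of "\<tau> - t" t n] that by (auto simp: norm_minus_commute)
          next
            case 2
            then show ?thesis using shift[of "t - \<tau>" \<tau> n] that by auto
          qed (use \<open>0 < \<epsilon>\<close> in simp)
        qed
        with d(1) T show ?thesis by (intro exI[of _ "min d T"]) auto
      qed
      from uniform_limit_subsequence[where w = w and u = \<rho>, OF T cont \<rho> this] show ?thesis by blast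
    qed
    have "\<exists>\<phi> g. strict_mono \<phi> \<and> g \<in> Lp_space {0<..<T} p \<and>
        (\<lambda>n. Lpnorm {0<..<T} p (\<lambda>t. v (\<phi> n) t - g t)) \<longlonglongrightarrow> 0"
      if v: "\<And>n. v n \<in> V" for v :: "nat \<Rightarrow> real \<Rightarrow> 'b"
    proof -
      obtain w where w: "\<And>n. continuous_on {0..T} (w n)"
        "\<And>n. AE t in lborel. t \<in> {0<..<T} \<longrightarrow> v n t = w n t"
        using representative[OF v] by metis
      obtain \<phi> g where \<phi>: "strict_mono \<phi>" and g: "continuous_on {0..T} g"
        and lim: "uniform_limit {0..T} (\<lambda>n. w (\<phi> n)) g sequentially"
        using subsequence[of w, OF w(1)] w(2) v by blast
      have "(\<lambda>n. Lpnorm {0<..<T} p (\<lambda>t. v (\<phi> n) t - g t)) \<longlonglongrightarrow> 0"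
      proof (rule tendsto_zero_ennreal)
        fix r :: real assume "0 < r"
        \<comment> \<open>Half of \<open>r\<close> leaves room for the strict inequality after
          passing to the infimum that defines the norm.\<close>
        then have "\<forall>\<^sub>F n in sequentially. \<forall>t\<in>{0..T}. dist (w (\<phi> n) t) (g t) < r / 2"
          by (intro uniform_limitD[OF lim]) simp
        then show "\<forall>\<^sub>F n in sequentially. Lpnorm {0<..<T} p (\<lambda>t. v (\<phi> n) t - g t) < ennreal r"
        proof eventually_elim
          case (elim n)
          then have le: "\<forall>t\<in>{0..T}. norm (w (\<phi> n) t - g t) \<le> r / 2"
            unfolding dist_norm by (blast intro: less_imp_le)
          have "AE t in lborel. t \<in> {0<..<T} \<longrightarrow> ennreal (norm (v (\<phi> n) t - g t)) \<le> ennreal (r / 2)"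
            using w(2)[of "\<phi> n"] by eventually_elim (use le in \<open>auto intro!: ennreal_leI\<close>)
          then have "Lpnorm {0<..<T} p (\<lambda>t. v (\<phi> n) t - g t) \<le> ennreal (r / 2)"
            unfolding True by (rule Lpnorm_top_le)
          also have "\<dots> < ennreal r" using \<open>0 < r\<close> by (simp add: ennreal_less_iff)
          finally show ?case .
        qed
      qed
      moreover have "g \<in> Lp_space {0<..<T} p"
        unfolding True using g T by (rule continuous_on_imp_Lp_space_top)
      ultimately show ?thesis using \<phi> by blast
    qed
    then show ?thesis
      unfolding AE_completion_iff using representative subsequence by blast
  qed
qed

end
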